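(* Let $X$ be a rack (respectively a quandle). The fundamental groupoid $\pi_1(X)$ (respectively $\pi_1^q(X)$) is given by the groupoid $\mathcal G_{(X,\mathrm{Pth}(X))}$ (respectively $\mathcal G_{(X,\mathrm{Pth}^\circ(X))}$) in $\mathsf{Set}$. Moreover, for a morphism $f\colon X\to Y$ of racks (respectively quandles), the groupoid morphism induced by $f$ via $\mathrm{Pth}$ (respectively $\mathrm{Pth}^\circ$) and $\mathcal G$ corresponds to $\pi_1(f)$ (respectively $\pi_1^q(f)$).
   Context: A rack is a set $X$ with two binary operations $\triangleleft,\triangleleft^{-1}$ such that $(x\triangleleft y)\triangleleft^{-1}y = x = (x\triangleleft^{-1}y)\triangleleft y$ and $(x\triangleleft y)\triangleleft z=(x\triangleleft z)\triangleleft(y\triangleleft z)$; a quandle is a rack with $x\triangleleft x=x$. (The operation $\triangleleft^{-1}$ is determined by $\triangleleft$.) $\pi_0(X)$ is the quotient of the set $X$ by the equivalence relation generated by the pairs $(x,x\triangleleft y)$; this gives a functor $\pi_0$ from racks (or quandles) to sets, left adjoint to the inclusion of sets as trivial racks ($x\triangleleft y=x$). $\mathrm{Pth}(X)$ is the group with generators $\underline x$ ($x\in X$) and relations $\underline{x\triangleleft a}=\underline a^{-1}\underline x\,\underline a$; it acts on the right on $X$ by $x\cdot\underline y=x\triangleleft y$. A morphism $f\colon X\to Y$ induces $\vec f\colon\mathrm{Pth}(X)\to\mathrm{Pth}(Y)$, $\underline x\mapsto\underline{f(x)}$. $\mathrm{Pth}^\circ(X)$ is the kernel of the homomorphism $\mathrm{Pth}(X)\to\mathbb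 Z$ sending every $\underline x$ to $1$; $\vec f$ restricts to $\mathrm{Pth}^\circ(X)\to\mathrm{Pth}^\circ(Y)$. For a rack $X$, $\tilde X$ is the rack with underlying set $X\times\mathrm{Pth}(X)$ and $(a,g)\triangleleft(b,h)=(a,gh^{-1}\underline b\,h)$; the weakly universal cover is $\omega_X\colon\tilde X\to X$, $(a,g)\mapsto a\cdot g$. For a quandle $X$, $\tilde X^\circ$ is the quandle with underlying set $X\times\mathrm{Pth}^\circ(X)$ and $(a,g)\triangleleft(b,h)=(a,\underline a^{-1}gh^{-1}\underline b\,h)$; the weakly universal cover is $\omega^q_X\colon\tilde X^\circ\to X$, $(a,g)\mapsto a\cdot g$. These are natural in $X$, with $f$ inducing $(a,g)\mapsto(f(a),\vec f(g))$. $\pi_1(X)$ (respectively $\pi^q_1(X)$) is the image under $\pi_0$ of the internal groupoid given by the kernel pair of $\omega_X$ (respectively $\omega^q_X$): writing $X'$ for the domain, this internal groupoid has object of objects $X'$, object of arrows $X_1'=\{(u,v)\in X'\times X'\mid u,v \text{ have the same image in } X\}$ (with componentwise operations), domain and codomain maps the first and second projections $d_1,d_2$, identities $u\mapsto(u,u)$, inverses $(u,v)\mapsto(v,u)$ and composition $((u,v),(v,w))\mapsto(u,w)$. Its image under $\pi_0$ is a groupoid in $\mathsf{Set}$, and naturality of $\omega$ (respectively $\omega^q$) makes $\pi_1$ (respectively $\pi_1^q$) a functor to groupoids. For a group $G$ acting on the right on a set $X$, $\mathcal G_{(X,G)}$ is the groupoid with set of objects $X$, set of arrows $X\times G$, domain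 $d(a,g)=a$, codomain $c(a,g)=a\cdot g$, identities $i(a)=(a,e)$, inverses $(a,g)^{-1}=(a\cdot g,g^{-1})$, and composition $m\langle(a,g),(b,h)\rangle=(a,gh)$ whenever $b=a\cdot g$. This construction is functorial in group actions. "Given by" is understood up to the canonical isomorphism identifying $\pi_0(X')$ with $X$ by $[(a,g)]\mapsto a$. *)

theory Defs
  imports "HOL-Algebra.Coset" "HOL-Algebra.Elementary_Groups"
begin

section \<open>Racks and quandles\<close>

record 'a rack = "'a partial_object" +
  rop  :: "'a \<Rightarrow> 'a \<Rightarrow> 'a"  (infixl \<open>\<triangleleft>\<index>\<close> 70)
  rinv :: "'a \<Rightarrow> 'a \<Rightarrow> 'a"  (infixl \<open>\<triangleleft>\<inverse>\<index>\<close> 70)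

locale rack =
  fixes X :: "'a rack" (structure)
  assumes rop_closed [simp, intro]:
      "\<lbrakk>x \<in> carrier X; y \<in> carrier X\<rbrakk> \<Longrightarrow> x \<triangleleft> y \<in> carrier X"
    and rinv_closed [simp, intro]:
      "\<lbrakk>x \<in> carrier X; y \<in> carrier X\<rbrakk> \<Longrightarrow> x \<triangleleft>\<inverse> y \<in> carrier X"
    and rop_rinv [simp]:
      "\<lbrakk>x \<in> carrier X; y \<in> carrier X\<rbrakk> \<Longrightarrow> (x \<triangleleft> y) \<triangleleft>\<inverse> y = x"
    and rinv_rop [simp]:
      "\<lbrakk>x \<in> carrier X; y \<in> carrier X\<rbrakk> \<Longrightarrow> (x \<triangleleft>\<inverse> y) \<triangleleft> y = x"
    and rop_distrib:
      "\<lbrakk>x \<in> carrier X; y \<in> carrier X; z \<in> carrier X\<rbrakk>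
        \<Longrightarrow> (x \<triangleleft> y) \<triangleleft> z = (x \<triangleleft> z) \<triangleleft> (y \<triangleleft> z)"

locale quandle = rack +
  assumes rop_idem [simp]: "x \<in> carrier X \<Longrightarrow> x \<triangleleft> x = x"

text \<open>Since the second operation is determined by the first one, morphisms are only
  required to preserve the first (see \<open>rack_hom_rinv\<close> below). Morphisms of quandles are
  the morphisms of the underlying racks.\<close>

definition rack_hom :: "'a rack \<Rightarrow> 'b rack \<Rightarrow> ('a \<Rightarrow> 'b) set" where
  "rack_hom X Y = {f \<in> carrier X \<rightarrow> carrier Y.
     \<forall>x\<in>carrier X. \<forall>y\<in>carrier X. f (x \<triangleleft>\<^bsub>X\<^esub> y) = f x \<triangleleft>\<^bsub>Y\<^esub> f y}"

lemma rack_hom_rinv: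
  assumes "rack X" "rack Y" "f \<in> rack_hom X Y" "x \<in> carrier X" "y \<in> carrier X"
  shows "f (x \<triangleleft>\<inverse>\<^bsub>X\<^esub> y) = f x \<triangleleft>\<inverse>\<^bsub>Y\<^esub> f y"
proof -
  interpret X: rack X by fact
  interpret Y: rack Y by fact
  have f: "f z \<in> carrier Y" if "z \<in> carrier X" for z
    using assms(3) that by (auto simp: rack_hom_def)
  let ?z = "x \<triangleleft>\<inverse>\<^bsub>X\<^esub> y"
  have "f (?z \<triangleleft>\<^bsub>X\<^esub> y) = f ?z \<triangleleft>\<^bsub>Y\<^esub> f y"
    using assms(3) X.rinv_closed [OF assms(4,5)] assms(5) unfolding rack_hom_def by blast
  then have "f x = f ?z \<triangleleft>\<^bsub>Y\<^esub> f y"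
    by (simp only: X.rinv_rop [OF assms(4,5)])
  then show ?thesis
    using Y.rop_rinv [OF f [OF X.rinv_closed [OF assms(4,5)]] f [OF assms(5)]] by simp
qed


section \<open>Connected components\<close>

definition conn :: "'a rack \<Rightarrow> ('a \<times> 'a) set" where
  "conn X = {(x, y) \<in> carrier X \<times> carrier X. (x, y) \<in>
     ({(a, a \<triangleleft>\<^bsub>X\<^esub> b) | a b. a \<in> carrier X \<and> b \<in> carrier X}
      \<union> {(a, a \<triangleleft>\<^bsub>X\<^esub> b) | a b. a \<in> carrier X \<and> b \<in> carrier X}\<inverse>)\<^sup>*}"

definition pi0 :: "'a rack \<Rightarrow> 'a set set" where
  "pi0 X = carrier X // conn X"

text \<open>\<open>pi0_map Y h\<close> sends the component of \<open>x\<close> to the component of \<open>h x\<close> in \<open>Y\<close>,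
  if \<open>h\<close> is a morphism of racks into \<open>Y\<close>.\<close>

definition pi0_map :: "'b rack \<Rightarrow> ('a \<Rightarrow> 'b) \<Rightarrow> 'a set \<Rightarrow> 'b set" where
  "pi0_map Y h C = conn Y `` (h ` C)"

lemma equiv_conn: "equiv (carrier X) (conn X)"
proof -
  define r where "r = {(a, a \<triangleleft>\<^bsub>X\<^esub> b) | a b. a \<in> carrier X \<and> b \<in> carrier X}"
  have c: "conn X = (carrier X \<times> carrier X) \<inter> (r \<union> r\<inverse>)\<^sup>*"
    unfolding conn_def r_def by blast
  have s: "sym ((r \<union> r\<inverse>)\<^sup>*)" by (intro sym_rtrancl sym_Un_converse)
  show ?thesis
  proof (rule equivI)
    show "conn X \<subseteq> carrier X \<times> carrier X" unfolding c by blast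
    show "refl_on (carrier X) (conn X)" unfolding c by (intro refl_onI) auto
    show "sym (conn X)" unfolding c by (rule symI) (use s in \<open>blast dest: symD\<close>)
    show "trans (conn X)" unfolding c by (rule transI) (blast intro: rtrancl_trans)
  qed
qed

lemma rack_hom_conn:
  assumes "f \<in> rack_hom X Y" "(x, y) \<in> conn X"
  shows "(f x, f y) \<in> conn Y"
proof -
  let ?R = "\<lambda>Z. {(a, rop Z a b) | a b. a \<in> carrier Z \<and> b \<in> carrier Z}"
  have R: "(f u, f v) \<in> ?R Y" if uv: "(u, v) \<in> ?R X" for u v
  proof -
    obtain b where b: "u \<in> carrier X" "b \<in> carrier X" "v = u \<triangleleft>\<^bsub>X\<^esub> b"
      using uv by blast
    then have "f u \<in> carrier Y" "f b \<in> carrier Y" "f v = f u \<triangleleft>\<^bsub>Y\<^esub> f b"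
      using assms(1) unfolding rack_hom_def by blast+
    then show ?thesis by blast
  qed
  have "(f x, f y) \<in> (?R Y \<union> (?R Y)\<inverse>)\<^sup>*"
    if "(x, y) \<in> (?R X \<union> (?R X)\<inverse>)\<^sup>*"
    using that
  proof (induction rule: rtrancl_induct)
    case base
    show ?case by (rule rtrancl_refl)
  next
    case (step u v)
    have "(f u, f v) \<in> ?R Y \<union> (?R Y)\<inverse>"
      using step.hyps(2) R [of u v] R [of v u] by blast
    with step.IH show ?case by (rule rtrancl_into_rtrancl)
  qed
  then show ?thesis using assms unfolding conn_def rack_hom_def by blast
qed

lemma pi0_map_class:
  assumes "f \<in> rack_hom X Y" "x \<in> carrier X"
  shows "pi0_map Y f (conn X `` {x}) = conn Y `` {f x}"
proof -
  have "conn Y `` {f y} = conn Y `` {f x}" if "(x, y) \<in> conn X" for y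
    using equiv_class_eq [OF equiv_conn rack_hom_conn [OF assms(1) that]] by simp
  then show ?thesis
    using equiv_class_self [OF equiv_conn assms(2)] unfolding pi0_map_def by blast
qed


section \<open>The group of paths\<close>

text \<open>Words in the letters \<open>(True, x)\<close>, standing for the generator given by \<open>x\<close>, and
  \<open>(False, x)\<close>, standing for its inverse, are taken modulo the congruence generated by free
  cancellation and the defining relations.  The closure premise of \<open>rel\<close> always holds in a
  rack; it keeps the relation within \<open>words X\<close> for arbitrary \<open>X\<close>.\<close>

type_synonym 'a word = "(bool \<times> 'a) list"

definition words :: "'a rack \<Rightarrow> 'a word set" where
  "words X = lists (UNIV \<times> carrier X)"

inductive pth_eq :: "'a rack \<Rightarrow> 'a word \<Rightarrow> 'a word \<Rightarrow> bool" for X where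
  refl: "w \<in> words X \<Longrightarrow> pth_eq X w w"
| sym: "pth_eq X u v \<Longrightarrow> pth_eq X v u"
| trans: "\<lbrakk>pth_eq X u v; pth_eq X v w\<rbrakk> \<Longrightarrow> pth_eq X u w"
| cong: "\<lbrakk>pth_eq X u v; p \<in> words X; q \<in> words X\<rbrakk> \<Longrightarrow> pth_eq X (p @ u @ q) (p @ v @ q)"
| cancel: "x \<in> carrier X \<Longrightarrow> pth_eq X [(b, x), (\<not> b, x)] []"
| rel: "\<lbrakk>x \<in> carrier X; a \<in> carrier X; x \<triangleleft>\<^bsub>X\<^esub> a \<in> carrier X\<rbrakk>
        \<Longrightarrow> pth_eq X [(True, x \<triangleleft>\<^bsub>X\<^esub> a)] [(False, a), (True, x), (True, a)]"

definition pth_class :: "'a rack \<Rightarrow> 'a word \<Rightarrow> 'a word set" where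
  "pth_class X w = {v. pth_eq X w v}"

definition Pth :: "'a rack \<Rightarrow> 'a word set monoid" where
  "Pth X = \<lparr>carrier = words X // {(u, v). pth_eq X u v},
            mult = (\<lambda>A B. \<Union>u\<in>A. \<Union>v\<in>B. pth_class X (u @ v)),
            one = pth_class X []\<rparr>"

definition gen :: "'a rack \<Rightarrow> 'a \<Rightarrow> 'a word set" where
  "gen X x = pth_class X [(True, x)]"

fun act_letter :: "'a rack \<Rightarrow> 'a \<Rightarrow> bool \<times> 'a \<Rightarrow> 'a" where
  "act_letter X a (b, y) = (if b then a \<triangleleft>\<^bsub>X\<^esub> y else a \<triangleleft>\<inverse>\<^bsub>X\<^esub> y)"

definition act_word :: "'a rack \<Rightarrow> 'a \<Rightarrow> 'a word \<Rightarrow> 'a" where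
  "act_word X = foldl (act_letter X)"

definition pth_act :: "'a rack \<Rightarrow> 'a \<Rightarrow> 'a word set \<Rightarrow> 'a" where
  "pth_act X a g = the_elem (act_word X a ` g)"

definition pth_map :: "'b rack \<Rightarrow> ('a \<Rightarrow> 'b) \<Rightarrow> 'a word set \<Rightarrow> 'b word set" where
  "pth_map Y f g = (\<Union>w\<in>g. pth_class Y (map (apsnd f) w))"

definition word_deg :: "'a word \<Rightarrow> int" where
  "word_deg w = (\<Sum>(b, x)\<leftarrow>w. if b then 1 else - 1)"

definition pth_deg :: "'a word set \<Rightarrow> int" where
  "pth_deg g = the_elem (word_deg ` g)"

definition Pth0 :: "'a rack \<Rightarrow> 'a word set monoid" where
  "Pth0 X = (Pth X)\<lparr>carrier := kernel (Pth X) integer_group pth_deg\<rparr>"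

lemma words_Nil [simp]: "[] \<in> words X"
  and words_Cons [simp]: "l # w \<in> words X \<longleftrightarrow> snd l \<in> carrier X \<and> w \<in> words X"
  and words_append [simp]: "u @ v \<in> words X \<longleftrightarrow> u \<in> words X \<and> v \<in> words X"
  by (cases l; auto simp: words_def)+

lemma pth_eq_words: "pth_eq X u v \<Longrightarrow> u \<in> words X \<and> v \<in> words X"
  by (induction rule: pth_eq.induct) auto

lemma pth_eq_append:
  assumes "pth_eq X u u'" "pth_eq X v v'"
  shows "pth_eq X (u @ v) (u' @ v')"
proof -
  have "pth_eq X (u @ v) (u' @ v)"
    using pth_eq.cong [OF assms(1), of "[]" v] pth_eq_words [OF assms(2)] by simp
  moreover have "pth_eq X (u' @ v) (u' @ v')"
    using pth_eq.cong [OF assms(2), of u' "[]"] pth_eq_words [OF assms(1)] by simp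
  ultimately show ?thesis by (rule pth_eq.trans)
qed

lemma pth_class_eq: "pth_eq X u v \<Longrightarrow> pth_class X u = pth_class X v"
  unfolding pth_class_def by (blast intro: pth_eq.sym pth_eq.trans)

lemma pth_class_self: "w \<in> words X \<Longrightarrow> w \<in> pth_class X w"
  by (simp add: pth_class_def pth_eq.refl)

lemma carrier_Pth: "carrier (Pth X) = pth_class X ` words X"
  by (auto simp: Pth_def quotient_def pth_class_def)

lemma one_Pth: "\<one>\<^bsub>Pth X\<^esub> = pth_class X []"
  by (simp add: Pth_def)

lemma mult_Pth:
  assumes "u \<in> words X" "v \<in> words X"
  shows "pth_class X u \<otimes>\<^bsub>Pth X\<^esub> pth_class X v = pth_class X (u @ v)"
proof -
  have *: "pth_class X (u' @ v') = pth_class X (u @ v)"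
    if "u' \<in> pth_class X u" "v' \<in> pth_class X v" for u' v'
  proof -
    have "pth_eq X (u @ v) (u' @ v')"
      using that by (intro pth_eq_append) (simp_all add: pth_class_def)
    then show ?thesis by (rule pth_class_eq [symmetric])
  qed
  have "pth_class X u \<otimes>\<^bsub>Pth X\<^esub> pth_class X v
      = (\<Union>u'\<in>pth_class X u. \<Union>v'\<in>pth_class X v. pth_class X (u' @ v'))"
    by (simp add: Pth_def)
  also have "\<dots> = pth_class X (u @ v)"
    using * pth_class_self [OF assms(1)] pth_class_self [OF assms(2)] by blast
  finally show ?thesis .
qed

lemma pth_cancel_words:
  "w \<in> words X \<Longrightarrow> pth_eq X (rev (map (\<lambda>(b, x). (\<not> b, x)) w) @ w) []"
proof (induction w)
  case (Cons l w)
  obtain b x where l: "l = (b, x)" by (cases l)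
  let ?r = "rev (map (\<lambda>(b, x). (\<not> b, x)) w)"
  have x: "x \<in> carrier X" and w: "w \<in> words X" using Cons.prems l by auto
  have r: "?r \<in> words X" using pth_eq_words [OF Cons.IH [OF w]] words_append by blast
  have "pth_eq X ([(\<not> b, x)] @ [(b, x)]) []" using pth_eq.cancel [OF x, of "\<not> b"] by simp
  from pth_eq.trans [OF pth_eq.cong [OF this r w]] Cons.IH [OF w] show ?case
    by (simp add: l)
qed (simp add: pth_eq.refl)

lemma group_Pth: "group (Pth X)"
proof (rule groupI)
  fix a b assume "a \<in> carrier (Pth X)" "b \<in> carrier (Pth X)"
  then show "a \<otimes>\<^bsub>Pth X\<^esub> b \<in> carrier (Pth X)"
    by (auto simp: carrier_Pth mult_Pth)
next
  show "\<one>\<^bsub>Pth X\<^esub> \<in> carrier (Pth X)" by (simp add: carrier_Pth one_Pth)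
next
  fix a b c assume "a \<in> carrier (Pth X)" "b \<in> carrier (Pth X)" "c \<in> carrier (Pth X)"
  then show "a \<otimes>\<^bsub>Pth X\<^esub> b \<otimes>\<^bsub>Pth X\<^esub> c = a \<otimes>\<^bsub>Pth X\<^esub> (b \<otimes>\<^bsub>Pth X\<^esub> c)"
    by (auto simp: carrier_Pth mult_Pth)
next
  fix a assume "a \<in> carrier (Pth X)"
  then obtain w where w: "w \<in> words X" "a = pth_class X w" by (auto simp: carrier_Pth)
  then show "\<one>\<^bsub>Pth X\<^esub> \<otimes>\<^bsub>Pth X\<^esub> a = a" by (simp add: one_Pth mult_Pth)
  let ?r = "rev (map (\<lambda>(b, x). (\<not> b, x)) w)"
  have e: "pth_eq X (?r @ w) []" by (rule pth_cancel_words [OF w(1)])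
  then have r: "?r \<in> words X" using pth_eq_words [OF e] words_append by blast
  show "\<exists>y\<in>carrier (Pth X). y \<otimes>\<^bsub>Pth X\<^esub> a = \<one>\<^bsub>Pth X\<^esub>"
    using w r pth_class_eq [OF e] by (auto simp: carrier_Pth one_Pth mult_Pth)
qed

lemma the_elem_pth_class:
  assumes "w \<in> words X" "\<And>v. pth_eq X w v \<Longrightarrow> F v = F w"
  shows "the_elem (F ` pth_class X w) = F w"
proof -
  have "F ` pth_class X w = {F w}"
    using assms(2) pth_class_self [OF assms(1)] unfolding pth_class_def by blast
  then show ?thesis by simp
qed

lemma pth_deg_class:
  assumes "w \<in> words X"
  shows "pth_deg (pth_class X w) = word_deg w"
proof -
  have *: "word_deg u = word_deg v" if "pth_eq X u v" for u v
    using that by (induction rule: pth_eq.induct) (auto simp: word_deg_def)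
  show ?thesis
    unfolding pth_deg_def by (rule the_elem_pth_class [OF assms *[symmetric]])
qed

lemma pth_deg_hom: "pth_deg \<in> hom (Pth X) integer_group"
  by (rule homI) (auto simp: carrier_Pth mult_Pth pth_deg_class word_deg_def integer_group_def)

lemma pth_deg_gen: "x \<in> carrier X \<Longrightarrow> pth_deg (gen X x) = 1"
  by (simp add: gen_def pth_deg_class word_deg_def)

lemma act_word_append: "act_word X a (u @ v) = act_word X (act_word X a u) v"
  by (simp add: act_word_def)

lemma (in rack) act_word_closed:
  "\<lbrakk>a \<in> carrier X; w \<in> words X\<rbrakk> \<Longrightarrow> act_word X a w \<in> carrier X"
proof (induction w arbitrary: a)
  case (Cons l w)
  obtain b x where l: "l = (b, x)" by (cases l)
  with Cons.prems have "act_letter X a l \<in> carrier X" "w \<in> words X" by simp_all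
  from Cons.IH [OF this] show ?case by (simp add: act_word_def)
qed (simp add: act_word_def)

lemma (in rack) act_word_eq:
  "\<lbrakk>pth_eq X u v; a \<in> carrier X\<rbrakk> \<Longrightarrow> act_word X a u = act_word X a v"
proof (induction arbitrary: a rule: pth_eq.induct)
  case (cong u v p q)
  then show ?case by (simp add: act_word_append act_word_closed)
next
  case (rel x b)
  then show ?case by (simp add: act_word_def rop_distrib)
qed (auto simp: act_word_def)

lemma (in rack) pth_act_class:
  "\<lbrakk>a \<in> carrier X; w \<in> words X\<rbrakk> \<Longrightarrow> pth_act X a (pth_class X w) = act_word X a w"
  unfolding pth_act_def by (rule the_elem_pth_class) (simp_all add: act_word_eq [symmetric])

lemma (in rack) pth_act_gen:
  "\<lbrakk>a \<in> carrier X; y \<in> carrier X\<rbrakk> \<Longrightarrow> pth_act X a (gen X y) = a \<triangleleft> y"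
  by (simp add: gen_def pth_act_class) (simp add: act_word_def)

lemma (in rack) pth_act_one: "a \<in> carrier X \<Longrightarrow> pth_act X a \<one>\<^bsub>Pth X\<^esub> = a"
  by (simp add: one_Pth pth_act_class) (simp add: act_word_def)

lemma (in rack) pth_act_mult:
  "\<lbrakk>a \<in> carrier X; g \<in> carrier (Pth X); h \<in> carrier (Pth X)\<rbrakk>
    \<Longrightarrow> pth_act X a (g \<otimes>\<^bsub>Pth X\<^esub> h) = pth_act X (pth_act X a g) h"
  by (auto simp: carrier_Pth mult_Pth pth_act_class act_word_closed act_word_append)

lemma map_words:
  "\<lbrakk>f \<in> carrier X \<rightarrow> carrier Y; w \<in> words X\<rbrakk> \<Longrightarrow> map (apsnd f) w \<in> words Y"
  by (induction w) auto

lemma pth_map_class: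
  assumes "f \<in> rack_hom X Y" "w \<in> words X"
  shows "pth_map Y f (pth_class X w) = pth_class Y (map (apsnd f) w)"
proof -
  have f: "f \<in> carrier X \<rightarrow> carrier Y" using assms(1) by (simp add: rack_hom_def)
  have "pth_eq Y (map (apsnd f) u) (map (apsnd f) v)" if "pth_eq X u v" for u v
    using that
  proof (induction rule: pth_eq.induct)
    case (cong u v p q)
    then show ?case using map_words [OF f] by (auto intro: pth_eq.cong)
  next
    case (cancel x b)
    then show ?case using f by (auto intro: pth_eq.cancel)
  next
    case (rel x a)
    then show ?case using f assms(1) pth_eq.rel [of "f x" Y "f a"]
      by (auto simp: rack_hom_def Pi_iff)
  next
    case (trans u v w)
    show ?case by (rule pth_eq.trans [OF trans.IH])
  next
    case (sym u v)
    show ?case by (rule pth_eq.sym [OF sym.IH])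
  qed (auto intro: pth_eq.refl map_words [OF f])
  then have "pth_class Y (map (apsnd f) v) = pth_class Y (map (apsnd f) w)"
    if "v \<in> pth_class X w" for v
    using that by (intro pth_class_eq [symmetric]) (simp add: pth_class_def)
  then show ?thesis
    using pth_class_self [OF assms(2)] unfolding pth_map_def by blast
qed

lemma pth_map_gen:
  "\<lbrakk>f \<in> rack_hom X Y; x \<in> carrier X\<rbrakk> \<Longrightarrow> pth_map Y f (gen X x) = gen Y (f x)"
  by (simp add: gen_def pth_map_class)

lemma pth_map_hom:
  assumes "f \<in> rack_hom X Y"
  shows "pth_map Y f \<in> hom (Pth X) (Pth Y)"
proof -
  have f: "f \<in> carrier X \<rightarrow> carrier Y" using assms(1) by (simp add: rack_hom_def)
  show ?thesis
    by (rule homI) (auto simp: carrier_Pth mult_Pth pth_map_class [OF assms] map_words [OF f])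
qed


section \<open>Weakly universal covers\<close>

type_synonym 'a cov = "'a \<times> 'a word set"

text \<open>In both covers the operation \<open>rinv\<close> is the one determined by \<open>rop\<close>.\<close>

definition cover :: "'a rack \<Rightarrow> 'a cov rack" where
  "cover X = \<lparr>carrier = carrier X \<times> carrier (Pth X),
     rop = (\<lambda>(a, g) (b, h). (a, g \<otimes>\<^bsub>Pth X\<^esub> inv\<^bsub>Pth X\<^esub> h \<otimes>\<^bsub>Pth X\<^esub> gen X b \<otimes>\<^bsub>Pth X\<^esub> h)),
     rinv = (\<lambda>(a, g) (b, h).
       (a, g \<otimes>\<^bsub>Pth X\<^esub> inv\<^bsub>Pth X\<^esub> h \<otimes>\<^bsub>Pth X\<^esub> inv\<^bsub>Pth X\<^esub> gen X b \<otimes>\<^bsub>Pth X\<^esub> h))\<rparr>"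

definition qcover :: "'a rack \<Rightarrow> 'a cov rack" where
  "qcover X = \<lparr>carrier = carrier X \<times> carrier (Pth0 X),
     rop = (\<lambda>(a, g) (b, h).
       (a, inv\<^bsub>Pth X\<^esub> gen X a \<otimes>\<^bsub>Pth X\<^esub> g \<otimes>\<^bsub>Pth X\<^esub> inv\<^bsub>Pth X\<^esub> h \<otimes>\<^bsub>Pth X\<^esub> gen X b \<otimes>\<^bsub>Pth X\<^esub> h)),
     rinv = (\<lambda>(a, g) (b, h).
       (a, gen X a \<otimes>\<^bsub>Pth X\<^esub> g \<otimes>\<^bsub>Pth X\<^esub> inv\<^bsub>Pth X\<^esub> h \<otimes>\<^bsub>Pth X\<^esub> inv\<^bsub>Pth X\<^esub> gen X b
          \<otimes>\<^bsub>Pth X\<^esub> h))\<rparr>"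

definition omega :: "'a rack \<Rightarrow> 'a cov \<Rightarrow> 'a" where
  "omega X = (\<lambda>(a, g). pth_act X a g)"

definition cover_map :: "'b rack \<Rightarrow> ('a \<Rightarrow> 'b) \<Rightarrow> 'a cov \<Rightarrow> 'b cov" where
  "cover_map Y f = map_prod f (pth_map Y f)"


section \<open>Groupoids in sets\<close>

text \<open>Composition is written in diagrammatic order.\<close>

record ('o, 'm) gpd =
  Obj :: "'o set"
  Arr :: "'m set"
  dm  :: "'m \<Rightarrow> 'o"
  cd  :: "'m \<Rightarrow> 'o"
  idn :: "'o \<Rightarrow> 'm"
  ivs :: "'m \<Rightarrow> 'm"
  cmp :: "'m \<Rightarrow> 'm \<Rightarrow> 'm"

locale groupoid =
  fixes G :: "('o, 'm) gpd" (structure)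
  assumes dm_closed: "p \<in> Arr G \<Longrightarrow> dm G p \<in> Obj G"
    and cd_closed: "p \<in> Arr G \<Longrightarrow> cd G p \<in> Obj G"
    and idn_closed: "x \<in> Obj G \<Longrightarrow> idn G x \<in> Arr G"
    and dm_idn: "x \<in> Obj G \<Longrightarrow> dm G (idn G x) = x"
    and cd_idn: "x \<in> Obj G \<Longrightarrow> cd G (idn G x) = x"
    and cmp_closed: "\<lbrakk>p \<in> Arr G; q \<in> Arr G; cd G p = dm G q\<rbrakk> \<Longrightarrow> cmp G p q \<in> Arr G"
    and dm_cmp: "\<lbrakk>p \<in> Arr G; q \<in> Arr G; cd G p = dm G q\<rbrakk> \<Longrightarrow> dm G (cmp G p q) = dm G p"
    and cd_cmp: "\<lbrakk>p \<in> Arr G; q \<in> Arr G; cd G p = dm G q\<rbrakk> \<Longrightarrow> cd G (cmp G p q) = cd G q"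
    and cmp_assoc: "\<lbrakk>p \<in> Arr G; q \<in> Arr G; r \<in> Arr G; cd G p = dm G q; cd G q = dm G r\<rbrakk>
        \<Longrightarrow> cmp G (cmp G p q) r = cmp G p (cmp G q r)"
    and cmp_idn_left: "p \<in> Arr G \<Longrightarrow> cmp G (idn G (dm G p)) p = p"
    and cmp_idn_right: "p \<in> Arr G \<Longrightarrow> cmp G p (idn G (cd G p)) = p"
    and ivs_closed: "p \<in> Arr G \<Longrightarrow> ivs G p \<in> Arr G"
    and dm_ivs: "p \<in> Arr G \<Longrightarrow> dm G (ivs G p) = cd G p"
    and cd_ivs: "p \<in> Arr G \<Longrightarrow> cd G (ivs G p) = dm G p"
    and cmp_ivs_right: "p \<in> Arr G \<Longrightarrow> cmp G p (ivs G p) = idn G (dm G p)"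
    and cmp_ivs_left: "p \<in> Arr G \<Longrightarrow> cmp G (ivs G p) p = idn G (cd G p)"

text \<open>A morphism of groupoids has a component \<open>F0\<close> on objects and a component \<open>F1\<close> on
  arrows.\<close>

definition groupoid_hom ::
  "('o, 'm) gpd \<Rightarrow> ('p, 'n) gpd \<Rightarrow> ('o \<Rightarrow> 'p) \<Rightarrow> ('m \<Rightarrow> 'n) \<Rightarrow> bool" where
  "groupoid_hom G H F0 F1 \<longleftrightarrow>
     groupoid G \<and> groupoid H \<and> F0 \<in> Obj G \<rightarrow> Obj H \<and> F1 \<in> Arr G \<rightarrow> Arr H \<and>
     (\<forall>p\<in>Arr G. dm H (F1 p) = F0 (dm G p)) \<and>
     (\<forall>p\<in>Arr G. cd H (F1 p) = F0 (cd G p)) \<and>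
     (\<forall>x\<in>Obj G. F1 (idn G x) = idn H (F0 x)) \<and>
     (\<forall>p\<in>Arr G. F1 (ivs G p) = ivs H (F1 p)) \<and>
     (\<forall>p\<in>Arr G. \<forall>q\<in>Arr G. cd G p = dm G q \<longrightarrow> F1 (cmp G p q) = cmp H (F1 p) (F1 q))"

definition groupoid_iso ::
  "('o, 'm) gpd \<Rightarrow> ('p, 'n) gpd \<Rightarrow> ('o \<Rightarrow> 'p) \<Rightarrow> ('m \<Rightarrow> 'n) \<Rightarrow> bool" where
  "groupoid_iso G H F0 F1 \<longleftrightarrow>
     groupoid_hom G H F0 F1 \<and> bij_betw F0 (Obj G) (Obj H) \<and> bij_betw F1 (Arr G) (Arr H)"

definition action_gpd :: "'a set \<Rightarrow> 'g monoid \<Rightarrow> ('a \<Rightarrow> 'g \<Rightarrow> 'a) \<Rightarrow> ('a, 'a \<times> 'g) gpd" where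
  "action_gpd S G act =
     \<lparr>Obj = S,
      Arr = S \<times> carrier G,
      dm = fst,
      cd = (\<lambda>(a, g). act a g),
      idn = (\<lambda>a. (a, \<one>\<^bsub>G\<^esub>)),
      ivs = (\<lambda>(a, g). (act a g, inv\<^bsub>G\<^esub> g)),
      cmp = (\<lambda>(a, g) (b, h). (a, g \<otimes>\<^bsub>G\<^esub> h))\<rparr>"

text \<open>A morphism of group actions, given by a map \<open>f\<close> of sets and an equivariant group
  homomorphism \<open>\<phi>\<close>, induces \<open>f\<close> on objects and the following map on arrows.\<close>

definition action_gpd_map :: "('a \<Rightarrow> 'b) \<Rightarrow> ('g \<Rightarrow> 'h) \<Rightarrow> 'a \<times> 'g \<Rightarrow> 'b \<times> 'h" where
  "action_gpd_map f \<phi> = map_prod f \<phi>"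


section \<open>The image under \<open>\<pi>\<^sub>0\<close> of a groupoid internal to racks\<close>

record ('o, 'm) rack_gpd =
  iobj :: "'o rack"
  iarr :: "'m rack"
  idm  :: "'m \<Rightarrow> 'o"
  icd  :: "'m \<Rightarrow> 'o"
  iidn :: "'o \<Rightarrow> 'm"
  iivs :: "'m \<Rightarrow> 'm"
  icmp :: "'m \<times> 'm \<Rightarrow> 'm"

text \<open>The pullback of \<open>icd\<close> and \<open>idm\<close>, on which \<open>icmp\<close> is defined.\<close>

definition composables :: "('o, 'm) rack_gpd \<Rightarrow> ('m \<times> 'm) rack" where
  "composables K = \<lparr>carrier = {(p, q). p \<in> carrier (iarr K) \<and> q \<in> carrier (iarr K)
                                     \<and> icd K p = idm K q},
     rop = (\<lambda>(p, q) (p', q'). (p \<triangleleft>\<^bsub>iarr K\<^esub> p', q \<triangleleft>\<^bsub>iarr K\<^esub> q')),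
     rinv = (\<lambda>(p, q) (p', q'). (p \<triangleleft>\<inverse>\<^bsub>iarr K\<^esub> p', q \<triangleleft>\<inverse>\<^bsub>iarr K\<^esub> q'))\<rparr>"

text \<open>The comparison map from \<open>\<pi>\<^sub>0\<close> of this pullback to the pullback of the images under
  \<open>\<pi>\<^sub>0\<close>.  The image of an internal groupoid under \<open>\<pi>\<^sub>0\<close> has a composition only if this map
  is bijective; the composition is then \<open>\<pi>\<^sub>0\<close> of \<open>icmp\<close> after the inverse of the comparison.\<close>

definition pi0_compare ::
  "('o, 'm) rack_gpd \<Rightarrow> ('m \<times> 'm) set \<Rightarrow> 'm set \<times> 'm set" where
  "pi0_compare K P = (pi0_map (iarr K) fst P, pi0_map (iarr K) snd P)"

definition pi0_preserves_composables :: "('o, 'm) rack_gpd \<Rightarrow> bool" where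
  "pi0_preserves_composables K \<longleftrightarrow>
     bij_betw (pi0_compare K) (pi0 (composables K))
       {(A, B). A \<in> pi0 (iarr K) \<and> B \<in> pi0 (iarr K)
          \<and> pi0_map (iobj K) (icd K) A = pi0_map (iobj K) (idm K) B}"

definition pi0_gpd :: "('o, 'm) rack_gpd \<Rightarrow> ('o set, 'm set) gpd" where
  "pi0_gpd K =
     \<lparr>Obj = pi0 (iobj K),
      Arr = pi0 (iarr K),
      dm = pi0_map (iobj K) (idm K),
      cd = pi0_map (iobj K) (icd K),
      idn = pi0_map (iarr K) (iidn K),
      ivs = pi0_map (iarr K) (iivs K),
      cmp = (\<lambda>A B. pi0_map (iarr K) (icmp K)
               (inv_into (pi0 (composables K)) (pi0_compare K) (A, B)))\<rparr>"


section \<open>Fundamental groupoids\<close>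

definition kernel_pair :: "'b rack \<Rightarrow> ('b \<Rightarrow> 'a) \<Rightarrow> ('b, 'b \<times> 'b) rack_gpd" where
  "kernel_pair X' w =
     \<lparr>iobj = X',
      iarr = \<lparr>carrier = {(u, v). u \<in> carrier X' \<and> v \<in> carrier X' \<and> w u = w v},
              rop = (\<lambda>(u, v) (u', v'). (u \<triangleleft>\<^bsub>X'\<^esub> u', v \<triangleleft>\<^bsub>X'\<^esub> v')),
              rinv = (\<lambda>(u, v) (u', v'). (u \<triangleleft>\<inverse>\<^bsub>X'\<^esub> u', v \<triangleleft>\<inverse>\<^bsub>X'\<^esub> v'))\<rparr>,
      idm = fst,
      icd = snd,
      iidn = (\<lambda>u. (u, u)),
      iivs = (\<lambda>(u, v). (v, u)),
      icmp = (\<lambda>((u, v), (v', t)). (u, t))\<rparr>"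

definition cover_gpd :: "'a rack \<Rightarrow> ('a cov, 'a cov \<times> 'a cov) rack_gpd" where
  "cover_gpd X = kernel_pair (cover X) (omega X)"

definition qcover_gpd :: "'a rack \<Rightarrow> ('a cov, 'a cov \<times> 'a cov) rack_gpd" where
  "qcover_gpd X = kernel_pair (qcover X) (omega X)"

definition pi1 :: "'a rack \<Rightarrow> ('a cov set, ('a cov \<times> 'a cov) set) gpd" where
  "pi1 X = pi0_gpd (cover_gpd X)"

definition pi1q :: "'a rack \<Rightarrow> ('a cov set, ('a cov \<times> 'a cov) set) gpd" where
  "pi1q X = pi0_gpd (qcover_gpd X)"

definition pi1_obj_map :: "'b rack \<Rightarrow> ('a \<Rightarrow> 'b) \<Rightarrow> 'a cov set \<Rightarrow> 'b cov set" where
  "pi1_obj_map Y f = pi0_map (iobj (cover_gpd Y)) (cover_map Y f)"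

definition pi1_arr_map ::
  "'b rack \<Rightarrow> ('a \<Rightarrow> 'b) \<Rightarrow> ('a cov \<times> 'a cov) set \<Rightarrow> ('b cov \<times> 'b cov) set" where
  "pi1_arr_map Y f = pi0_map (iarr (cover_gpd Y)) (map_prod (cover_map Y f) (cover_map Y f))"

definition pi1q_obj_map :: "'b rack \<Rightarrow> ('a \<Rightarrow> 'b) \<Rightarrow> 'a cov set \<Rightarrow> 'b cov set" where
  "pi1q_obj_map Y f = pi0_map (iobj (qcover_gpd Y)) (cover_map Y f)"

definition pi1q_arr_map ::
  "'b rack \<Rightarrow> ('a \<Rightarrow> 'b) \<Rightarrow> ('a cov \<times> 'a cov) set \<Rightarrow> ('b cov \<times> 'b cov) set" where
  "pi1q_arr_map Y f = pi0_map (iarr (qcover_gpd Y)) (map_prod (cover_map Y f) (cover_map Y f))"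

text \<open>The canonical identification, serving both cases: on objects \<open>[(a, g)]\<close> corresponds
  to \<open>a\<close>, and on arrows \<open>[((a, g), (b, h))]\<close> corresponds to the arrow \<open>(a, g h\<inverse>)\<close>, whose
  codomain is \<open>b\<close> because \<open>a \<cdot> g = b \<cdot> h\<close>.\<close>

definition can_obj :: "'a cov set \<Rightarrow> 'a" where
  "can_obj C = the_elem (fst ` C)"

definition can_arr :: "'a rack \<Rightarrow> ('a cov \<times> 'a cov) set \<Rightarrow> 'a \<times> 'a word set" where
  "can_arr X A = the_elem ((\<lambda>((a, g), (b, h)). (a, g \<otimes>\<^bsub>Pth X\<^esub> inv\<^bsub>Pth X\<^esub> h)) ` A)"

end

theory Submission
  imports Defs
begin

text \<open>
  The point is that the covers are right translations in disguise. In the path group,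
  \<open>h\<inverse> (gen b) h\<close> is the generator given by \<open>b \<cdot> h\<close> (lemma \<open>gen_pth_act\<close>). Hence, for racks,
  \<open>(a, g) \<triangleleft> (b, h) = (a, g (gen x))\<close> where \<open>x = b \<cdot> h\<close> is the image of \<open>(b, h)\<close> in \<open>X\<close>. For
  quandles, the factor \<open>(gen a)\<inverse>\<close> on the left can be moved to the right of \<open>g\<close>, and
  \<open>(a, g) \<triangleleft> (b, h) = (a, g (gen p)\<inverse> (gen x))\<close> where \<open>p = a \<cdot> g\<close> is the image of \<open>(a, g)\<close>. In
  both cases the first coordinate is fixed and the second one is translated by an element of
  the group \<open>H\<close>, equal to \<open>Pth X\<close> or \<open>Pth0 X\<close>, that depends only on the images in \<open>X\<close>.

  Elements of the kernel pair, or composable pairs of such, have one image in \<open>X\<close>, so in these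
  racks too \<open>\<triangleleft>\<close> is a simultaneous translation of all coordinates. Because the occurring
  elements generate \<open>H\<close> in a suitable sense, the connected components of all three racks are
  the orbits of \<open>H\<close> acting by translation (lemma \<open>conn_orbits\<close>). These orbits are visible: the
  orbit of \<open>(a, g)\<close> is given by \<open>a\<close>, that of \<open>((a, g), (b, h))\<close> by \<open>(a, g h\<inverse>)\<close>, where \<open>b\<close> is
  recovered as \<open>a \<cdot> g h\<inverse>\<close>, and that of a composable pair by the two invariants of its members
  (lemmas \<open>obj_complete\<close>, \<open>arr_complete\<close>, \<open>comp_complete\<close>). These are the objects, the arrows
  and the composable pairs of the action groupoid. It follows that \<open>\<pi>\<^sub>0\<close> preserves the pullback
  of composable pairs, and the structure maps agree on representatives, composition being
  \<open>(g h\<inverse>) (h k\<inverse>) = g k\<inverse>\<close> (lemma \<open>pi0_groupoid_iso\<close>).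

  The only step that separates racks from quandles is generation. Generators of \<open>Pth X\<close> reach
  everything by definition. In \<open>Pth0 X\<close>, a path \<open>k\<close> is built letter by letter while being kept
  in degree zero by a power of \<open>gen p\<close> on its left (lemma \<open>path_cover_qcover\<close>). Naturality
  is checked on representatives, because a morphism of racks commutes with the action of
  paths (lemma \<open>pth_act_map\<close>).
\<close>

section \<open>Components detected by an invariant\<close>

text \<open>The value \<open>\<kappa> z\<close> is a coordinate for the component of \<open>z\<close>: it identifies \<open>pi0 Z\<close>
  with \<open>S\<close>.\<close>
definition complete_invariant :: "'z rack \<Rightarrow> ('z \<Rightarrow> 's) \<Rightarrow> 's set \<Rightarrow> bool" where
  "complete_invariant Z \<kappa> S \<longleftrightarrow> \<kappa> ` carrier Z = S \<and>
     (\<forall>z\<in>carrier Z. \<forall>z'\<in>carrier Z. (z, z') \<in> conn Z \<longleftrightarrow> \<kappa> z = \<kappa> z')"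

lemma complete_invariant_the_elem:
  assumes "complete_invariant Z \<kappa> S" "z \<in> carrier Z"
  shows "the_elem (\<kappa> ` (conn Z `` {z})) = \<kappa> z"
proof -
  have "conn Z \<subseteq> carrier Z \<times> carrier Z" by (auto simp: conn_def)
  then have "\<kappa> z' = \<kappa> z" if "z' \<in> conn Z `` {z}" for z'
    using assms that unfolding complete_invariant_def by (metis Image_singleton_iff SigmaD2 subsetD)
  moreover have "z \<in> conn Z `` {z}" by (rule equiv_class_self [OF equiv_conn assms(2)])
  ultimately have "\<kappa> ` (conn Z `` {z}) = {\<kappa> z}" by blast
  then show ?thesis by simp
qed

lemma pi0_cases:
  assumes "C \<in> pi0 Z"
  obtains z where "z \<in> carrier Z" "C = conn Z `` {z}"
  using assms by (auto simp: pi0_def elim: quotientE)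

lemma pi0_class: "z \<in> carrier Z \<Longrightarrow> conn Z `` {z} \<in> pi0 Z"
  by (simp add: pi0_def quotientI)

lemma complete_invariant_bij:
  assumes "complete_invariant Z \<kappa> S"
  shows "bij_betw (\<lambda>C. the_elem (\<kappa> ` C)) (pi0 Z) S"
proof (rule bij_betwI')
  fix C D assume "C \<in> pi0 Z" "D \<in> pi0 Z"
  then obtain z w where "z \<in> carrier Z" "C = conn Z `` {z}" "w \<in> carrier Z" "D = conn Z `` {w}"
    by (metis pi0_cases)
  then show "(the_elem (\<kappa> ` C) = the_elem (\<kappa> ` D)) = (C = D)"
    using assms equiv_class_eq_iff [OF equiv_conn, of z w Z]
    by (simp add: complete_invariant_the_elem [OF assms] complete_invariant_def)
next
  fix C assume "C \<in> pi0 Z"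
  then show "the_elem (\<kappa> ` C) \<in> S"
    using assms by (elim pi0_cases)
      (auto simp: complete_invariant_the_elem [OF assms] complete_invariant_def)
next
  fix s assume "s \<in> S"
  then obtain z where "z \<in> carrier Z" "s = \<kappa> z" using assms by (auto simp: complete_invariant_def)
  then show "\<exists>C\<in>pi0 Z. s = the_elem (\<kappa> ` C)"
    by (metis complete_invariant_the_elem [OF assms] pi0_class)
qed

lemma pi0_map_closed:
  assumes "h \<in> rack_hom Z W" "C \<in> pi0 Z"
  shows "pi0_map W h C \<in> pi0 W"
  using assms by (elim pi0_cases) (auto simp: pi0_map_class rack_hom_def intro!: pi0_class)

section \<open>Groupoids transported along bijections\<close>

text \<open>That \<open>G\<close> is a groupoid belongs to the conclusion: since both components are injective,
  each axiom for \<open>G\<close> can be tested after applying them, where it becomes the same axiom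
  for \<open>H\<close>.\<close>
lemma groupoid_iso_transport:
  assumes H: "groupoid H"
    and F0: "bij_betw F0 (Obj G) (Obj H)" and F1: "bij_betw F1 (Arr G) (Arr H)"
    and dm: "\<And>p. p \<in> Arr G \<Longrightarrow> dm G p \<in> Obj G \<and> F0 (dm G p) = dm H (F1 p)"
    and cd: "\<And>p. p \<in> Arr G \<Longrightarrow> cd G p \<in> Obj G \<and> F0 (cd G p) = cd H (F1 p)"
    and idn: "\<And>x. x \<in> Obj G \<Longrightarrow> idn G x \<in> Arr G \<and> F1 (idn G x) = idn H (F0 x)"
    and ivs: "\<And>p. p \<in> Arr G \<Longrightarrow> ivs G p \<in> Arr G \<and> F1 (ivs G p) = ivs H (F1 p)"
    and cmp: "\<And>p q. \<lbrakk>p \<in> Arr G; q \<in> Arr G; cd G p = dm G q\<rbrakk>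
      \<Longrightarrow> cmp G p q \<in> Arr G \<and> F1 (cmp G p q) = cmp H (F1 p) (F1 q)"
  shows "groupoid_iso G H F0 F1"
proof -
  interpret H: groupoid H by fact
  have eq0: "x = y" if "F0 x = F0 y" "x \<in> Obj G" "y \<in> Obj G" for x y
    using that F0 by (auto simp: bij_betw_def dest: inj_onD)
  have eq1: "p = q" if "F1 p = F1 q" "p \<in> Arr G" "q \<in> Arr G" for p q
    using that F1 by (auto simp: bij_betw_def dest: inj_onD)
  have F0c: "F0 x \<in> Obj H" if "x \<in> Obj G" for x using that F0 by (auto simp: bij_betw_def)
  have F1c: "F1 p \<in> Arr H" if "p \<in> Arr G" for p using that F1 by (auto simp: bij_betw_def)
  note s = dm cd idn ivs cmp F0c F1c
  have F0eq: "cd H (F1 p) = dm H (F1 q)" if "cd G p = dm G q" "p \<in> Arr G" "q \<in> Arr G" for p q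
    using that by (metis dm cd)
  have "groupoid G"
  proof
    fix x assume "x \<in> Obj G"
    then show "idn G x \<in> Arr G" "dm G (idn G x) = x" "cd G (idn G x) = x"
      by (simp_all add: s eq0 H.dm_idn H.cd_idn)
  next
    fix p assume p: "p \<in> Arr G"
    show "dm G p \<in> Obj G" "cd G p \<in> Obj G" "ivs G p \<in> Arr G" using p by (simp_all add: s)
    show d: "dm G (ivs G p) = cd G p" and c: "cd G (ivs G p) = dm G p"
      using p by (auto intro!: eq0 simp: s H.dm_ivs H.cd_ivs)
    have di: "cd G (idn G (dm G p)) = dm G p" "dm G (idn G (cd G p)) = cd G p"
      using p by (auto intro!: eq0 simp: s H.dm_idn H.cd_idn H.dm_closed H.cd_closed)
    show "cmp G (idn G (dm G p)) p = p" "cmp G p (idn G (cd G p)) = p"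
      using p di by (auto intro!: eq1 simp: s H.cmp_idn_left H.cmp_idn_right)
    show "cmp G p (ivs G p) = idn G (dm G p)" "cmp G (ivs G p) p = idn G (cd G p)"
      using p d c by (auto intro!: eq1 simp: s H.cmp_ivs_left H.cmp_ivs_right)
  next
    fix p q assume p: "p \<in> Arr G" and q: "q \<in> Arr G" and pq: "cd G p = dm G q"
    show "cmp G p q \<in> Arr G" using p q pq by (simp add: s)
    show d: "dm G (cmp G p q) = dm G p" and c: "cd G (cmp G p q) = cd G q"
      using p q pq F0eq [OF pq p q] by (auto intro!: eq0 simp: s H.dm_cmp H.cd_cmp)
    fix r assume r: "r \<in> Arr G" and qr: "cd G q = dm G r"
    have "dm G (cmp G q r) = dm G q"
      using r q qr F0eq [OF qr q r] by (auto intro!: eq0 simp: s H.dm_cmp)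
    then show "cmp G (cmp G p q) r = cmp G p (cmp G q r)"
      using p q r pq qr c F0eq [OF pq p q] F0eq [OF qr q r]
      by (auto intro!: eq1 simp: s H.cmp_assoc)
  qed
  then show ?thesis
    using H F0 F1 by (auto simp: groupoid_iso_def groupoid_hom_def s)
qed

text \<open>Again by injectivity of \<open>F0\<close> and \<open>F1\<close>: a square over a morphism of groupoids whose
  vertical sides are isomorphisms has a morphism of groupoids on its other horizontal side.\<close>
lemma groupoid_hom_transport:
  assumes G: "groupoid_iso G G' E0 E1" and H: "groupoid_iso H H' F0 F1"
    and \<phi>: "groupoid_hom G' H' \<phi>0 \<phi>1"
    and c0: "\<psi>0 \<in> Obj G \<rightarrow> Obj H" and c1: "\<psi>1 \<in> Arr G \<rightarrow> Arr H"
    and e0: "\<And>x. x \<in> Obj G \<Longrightarrow> F0 (\<psi>0 x) = \<phi>0 (E0 x)"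
    and e1: "\<And>p. p \<in> Arr G \<Longrightarrow> F1 (\<psi>1 p) = \<phi>1 (E1 p)"
  shows "groupoid_hom G H \<psi>0 \<psi>1"
proof -
  have gG: "groupoid_hom G G' E0 E1" and gH: "groupoid_hom H H' F0 F1"
    using G H by (auto simp: groupoid_iso_def)
  interpret G: groupoid G using gG by (simp add: groupoid_hom_def)
  interpret H: groupoid H using gH by (simp add: groupoid_hom_def)
  have eq0: "x = y" if "F0 x = F0 y" "x \<in> Obj H" "y \<in> Obj H" for x y
    using that H by (auto simp: groupoid_iso_def bij_betw_def dest: inj_onD)
  have eq1: "p = q" if "F1 p = F1 q" "p \<in> Arr H" "q \<in> Arr H" for p q
    using that H by (auto simp: groupoid_iso_def bij_betw_def dest: inj_onD)
  have c0': "\<psi>0 x \<in> Obj H" if "x \<in> Obj G" for x using c0 that by auto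
  have c1': "\<psi>1 p \<in> Arr H" if "p \<in> Arr G" for p using c1 that by auto
  have E: "E0 x \<in> Obj G'" if "x \<in> Obj G" for x using gG that by (auto simp: groupoid_hom_def)
  have E': "E1 x \<in> Arr G'" if "x \<in> Arr G" for x using gG that by (auto simp: groupoid_hom_def)
  note s = c0' c1' e0 e1 E E' G.dm_closed G.cd_closed G.idn_closed G.ivs_closed G.cmp_closed
    H.dm_closed H.cd_closed H.idn_closed H.ivs_closed H.cmp_closed
  have g: "\<And>p. p \<in> Arr G \<Longrightarrow> dm G' (E1 p) = E0 (dm G p)"
    "\<And>p. p \<in> Arr G \<Longrightarrow> cd G' (E1 p) = E0 (cd G p)"
    "\<And>x. x \<in> Obj G \<Longrightarrow> E1 (idn G x) = idn G' (E0 x)"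
    "\<And>p. p \<in> Arr G \<Longrightarrow> E1 (ivs G p) = ivs G' (E1 p)"
    "\<And>p q. \<lbrakk>p \<in> Arr G; q \<in> Arr G; cd G p = dm G q\<rbrakk> \<Longrightarrow> E1 (cmp G p q) = cmp G' (E1 p) (E1 q)"
    using gG by (auto simp: groupoid_hom_def)
  have h: "\<And>p. p \<in> Arr H \<Longrightarrow> F0 (dm H p) = dm H' (F1 p)"
    "\<And>p. p \<in> Arr H \<Longrightarrow> F0 (cd H p) = cd H' (F1 p)"
    "\<And>x. x \<in> Obj H \<Longrightarrow> F1 (idn H x) = idn H' (F0 x)"
    "\<And>p. p \<in> Arr H \<Longrightarrow> F1 (ivs H p) = ivs H' (F1 p)"
    "\<And>p q. \<lbrakk>p \<in> Arr H; q \<in> Arr H; cd H p = dm H q\<rbrakk> \<Longrightarrow> F1 (cmp H p q) = cmp H' (F1 p) (F1 q)"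
    using gH by (auto simp: groupoid_hom_def)
  have f: "\<And>p. p \<in> Arr G' \<Longrightarrow> dm H' (\<phi>1 p) = \<phi>0 (dm G' p)"
    "\<And>p. p \<in> Arr G' \<Longrightarrow> cd H' (\<phi>1 p) = \<phi>0 (cd G' p)"
    "\<And>x. x \<in> Obj G' \<Longrightarrow> \<phi>1 (idn G' x) = idn H' (\<phi>0 x)"
    "\<And>p. p \<in> Arr G' \<Longrightarrow> \<phi>1 (ivs G' p) = ivs H' (\<phi>1 p)"
    "\<And>p q. \<lbrakk>p \<in> Arr G'; q \<in> Arr G'; cd G' p = dm G' q\<rbrakk> \<Longrightarrow> \<phi>1 (cmp G' p q) = cmp H' (\<phi>1 p) (\<phi>1 q)"
    using \<phi> by (auto simp: groupoid_hom_def)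
  have d: "dm H (\<psi>1 p) = \<psi>0 (dm G p)" "cd H (\<psi>1 p) = \<psi>0 (cd G p)" if "p \<in> Arr G" for p
    using that by (auto intro!: eq0 simp: s g h f)
  have "\<psi>1 (cmp G p q) = cmp H (\<psi>1 p) (\<psi>1 q)"
    if "p \<in> Arr G" "q \<in> Arr G" "cd G p = dm G q" for p q
    using that by (auto intro!: eq1 simp: s g h f d)
  moreover have "\<psi>1 (idn G x) = idn H (\<psi>0 x)" if "x \<in> Obj G" for x
    using that by (auto intro!: eq1 simp: s g h f)
  moreover have "\<psi>1 (ivs G p) = ivs H (\<psi>1 p)" if "p \<in> Arr G" for p
    using that by (auto intro!: eq1 simp: s g h f)
  ultimately show ?thesis
    using c0 c1 d G.groupoid_axioms H.groupoid_axioms by (simp add: groupoid_hom_def)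
qed

lemma groupoid_action_gpd:
  fixes G (structure)
  assumes "group G"
    and closed: "\<And>a g. \<lbrakk>a \<in> S; g \<in> carrier G\<rbrakk> \<Longrightarrow> act a g \<in> S"
    and one: "\<And>a. a \<in> S \<Longrightarrow> act a \<one> = a"
    and mult: "\<And>a g h. \<lbrakk>a \<in> S; g \<in> carrier G; h \<in> carrier G\<rbrakk> \<Longrightarrow> act a (g \<otimes> h) = act (act a g) h"
  shows "groupoid (action_gpd S G act)"
proof -
  interpret group G by fact
  have "act (act a g) (inv g) = a" if "a \<in> S" "g \<in> carrier G" for a g
    using mult [of a g "inv g"] that by (simp add: one)
  then show ?thesis
    by unfold_locales (auto simp: action_gpd_def closed one mult m_assoc)
qed

section \<open>The path group and its action\<close>

sublocale rack \<subseteq> P: group "Pth X"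
  by (rule group_Pth)

context rack
begin

lemma gen_closed [simp, intro]: "y \<in> carrier X \<Longrightarrow> gen X y \<in> carrier (Pth X)"
  by (simp add: gen_def carrier_Pth)

lemma pth_act_closed [simp, intro]:
  "\<lbrakk>a \<in> carrier X; g \<in> carrier (Pth X)\<rbrakk> \<Longrightarrow> pth_act X a g \<in> carrier X"
  by (auto simp: carrier_Pth pth_act_class act_word_closed)

lemma P_cancel:
  assumes "g \<in> carrier (Pth X)" "h \<in> carrier (Pth X)"
  shows "inv\<^bsub>Pth X\<^esub> g \<otimes>\<^bsub>Pth X\<^esub> (g \<otimes>\<^bsub>Pth X\<^esub> h) = h"
    and "g \<otimes>\<^bsub>Pth X\<^esub> (inv\<^bsub>Pth X\<^esub> g \<otimes>\<^bsub>Pth X\<^esub> h) = h"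
  using assms by (simp_all flip: P.m_assoc)

lemma pth_act_inv:
  "\<lbrakk>a \<in> carrier X; g \<in> carrier (Pth X)\<rbrakk> \<Longrightarrow> pth_act X (pth_act X a g) (inv\<^bsub>Pth X\<^esub> g) = a"
  by (simp add: pth_act_one flip: pth_act_mult)

text \<open>The defining relation of the path group, stated with the group inverse in place of the
  letter \<open>(False, a)\<close>.\<close>
lemma gen_rop:
  assumes "x \<in> carrier X" "a \<in> carrier X"
  shows "gen X (x \<triangleleft> a) = inv\<^bsub>Pth X\<^esub> gen X a \<otimes>\<^bsub>Pth X\<^esub> gen X x \<otimes>\<^bsub>Pth X\<^esub> gen X a"
proof -
  have "pth_class X [(False, a)] \<otimes>\<^bsub>Pth X\<^esub> gen X a = \<one>\<^bsub>Pth X\<^esub>"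
    using assms pth_class_eq [OF pth_eq.cancel [of a X False]]
    by (simp add: gen_def mult_Pth one_Pth)
  then have "inv\<^bsub>Pth X\<^esub> gen X a = pth_class X [(False, a)]"
    using assms by (intro P.inv_equality) (auto simp: carrier_Pth gen_def)
  then show ?thesis
    using assms pth_class_eq [OF pth_eq.rel [of x X a]] by (simp add: gen_def mult_Pth)
qed

text \<open>Since the step hypothesis is an equivalence, it covers multiplication by the inverse of
  a generator as well: read it at \<open>k \<otimes> inv (gen y)\<close> from right to left.\<close>
lemma Pth_induct [consumes 1, case_names one gen]:
  assumes "k \<in> carrier (Pth X)"
    and one: "Q \<one>\<^bsub>Pth X\<^esub>"
    and gen: "\<And>k y. \<lbrakk>k \<in> carrier (Pth X); y \<in> carrier X\<rbrakk> \<Longrightarrow> Q k \<longleftrightarrow> Q (k \<otimes>\<^bsub>Pth X\<^esub> gen X y)"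
  shows "Q k"
proof -
  have "Q (pth_class X w)" if "w \<in> words X" for w
    using that
  proof (induction w rule: rev_induct)
    case Nil
    then show ?case using one by (simp add: one_Pth)
  next
    case (snoc l w)
    obtain b y where l: "l = (b, y)" by (cases l)
    have w: "w \<in> words X" and y: "y \<in> carrier X" using snoc.prems l by auto
    show ?case
    proof (cases b)
      case True
      then show ?thesis
        using gen [of "pth_class X w" y] snoc.IH w y l
        by (simp add: carrier_Pth gen_def mult_Pth)
    next
      case False
      have "pth_eq X (w @ [(False, y), (True, y)] @ []) (w @ [] @ [])"
        using pth_eq.cong [OF pth_eq.cancel [OF y, of False], of w "[]"] w by simp
      then have "pth_class X (w @ [(False, y)]) \<otimes>\<^bsub>Pth X\<^esub> gen X y = pth_class X w"
        using w y by (simp add: gen_def mult_Pth pth_class_eq)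
      then show ?thesis
        using gen [of "pth_class X (w @ [(False, y)])" y] snoc.IH w y l False
        by (simp add: carrier_Pth)
    qed
  qed
  then show ?thesis using assms(1) by (auto simp: carrier_Pth)
qed

text \<open>The defining relation says this for generators \<open>g\<close>. It is the reason why the
  operations of both covers see their second argument only through its image in \<open>X\<close>:
  \<open>h\<inverse> (gen b) h\<close> is the generator given by \<open>b \<cdot> h\<close>.\<close>
lemma gen_pth_act:
  assumes "g \<in> carrier (Pth X)" "x \<in> carrier X"
  shows "gen X (pth_act X x g) = inv\<^bsub>Pth X\<^esub> g \<otimes>\<^bsub>Pth X\<^esub> gen X x \<otimes>\<^bsub>Pth X\<^esub> g"
  using assms
proof (induction rule: Pth_induct)
  case one
  then show ?case by (simp add: pth_act_one)
next
  case (gen k y)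
  let ?a = "gen X (pth_act X x k)"
  have "gen X (pth_act X x (k \<otimes>\<^bsub>Pth X\<^esub> gen X y)) = inv\<^bsub>Pth X\<^esub> gen X y \<otimes>\<^bsub>Pth X\<^esub> ?a \<otimes>\<^bsub>Pth X\<^esub> gen X y"
    using gen assms by (simp add: pth_act_mult pth_act_gen gen_rop)
  then show ?case
    using gen assms by (simp add: P.inv_mult_group P.m_assoc)
      (simp flip: P.m_assoc)
qed

end

section \<open>Covers whose operation is translation by paths\<close>

text \<open>What the two weakly universal covers have in common: the element \<open>v\<close> acts on \<open>u\<close> by
  right translation with an element of \<open>H\<close> that depends only on the images of \<open>u\<close> and \<open>v\<close>
  in \<open>X\<close>. The hypothesis \<open>delta_induct\<close> says that these translations suffice to reach
  every \<open>k\<close> in \<open>H\<close>. It involves a base point \<open>p\<close> because the available translations may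
  change along the way: once the base point has been moved by \<open>k\<close>, the next translation
  is taken at \<open>p \<cdot> k\<close>.\<close>
locale path_cover = rack X for X :: "'a rack" (structure) +
  fixes H :: "'a word set set" and \<delta> :: "'a \<Rightarrow> 'a \<Rightarrow> 'a word set" and X' :: "'a cov rack"
  assumes subgroup_H: "subgroup H (Pth X)"
    and delta_closed: "\<lbrakk>p \<in> carrier X; y \<in> carrier X\<rbrakk> \<Longrightarrow> \<delta> p y \<in> H"
    and delta_induct: "\<And>p k Q. \<lbrakk>p \<in> carrier X; k \<in> H; Q \<one>\<^bsub>Pth X\<^esub>;
        \<And>k y. \<lbrakk>k \<in> H; y \<in> carrier X\<rbrakk> \<Longrightarrow> Q k \<longleftrightarrow> Q (k \<otimes>\<^bsub>Pth X\<^esub> \<delta> (pth_act X p k) y)\<rbrakk> \<Longrightarrow> Q k"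
    and carrier_X': "carrier X' = carrier X \<times> H"
    and rop_X': "\<lbrakk>u \<in> carrier X'; v \<in> carrier X'\<rbrakk> \<Longrightarrow>
        u \<triangleleft>\<^bsub>X'\<^esub> v = (fst u, snd u \<otimes>\<^bsub>Pth X\<^esub> \<delta> (omega X u) (omega X v))"
begin

abbreviation ker_pair where "ker_pair \<equiv> kernel_pair X' (omega X)"
abbreviation act_gpd where "act_gpd \<equiv> action_gpd (carrier X) ((Pth X)\<lparr>carrier := H\<rparr>) (pth_act X)"

lemma H_closed [simp, intro]:
  "\<one>\<^bsub>Pth X\<^esub> \<in> H"
  "k \<in> H \<Longrightarrow> inv\<^bsub>Pth X\<^esub> k \<in> H"
  "\<lbrakk>k \<in> H; l \<in> H\<rbrakk> \<Longrightarrow> k \<otimes>\<^bsub>Pth X\<^esub> l \<in> H"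
  "k \<in> H \<Longrightarrow> k \<in> carrier (Pth X)"
  using subgroup_H by (auto intro: subgroup.m_closed subgroup.m_inv_closed subgroup.one_closed
      dest: subgroup.mem_carrier)

text \<open>The central point. It is stated for any \<open>Z\<close> that lies over \<open>X\<close> by \<open>q\<close> and carries an
  equivariant right action \<open>t\<close> of \<open>H\<close>, because it is applied to the cover, to its kernel pair
  and to the composable pairs of the latter: elements of a fibre product over \<open>X\<close> share one
  image in \<open>X\<close>, so that all their coordinates are translated by the same element of \<open>H\<close>.\<close>
lemma conn_orbits:
  fixes Z :: "'z rack" and q :: "'z \<Rightarrow> 'a" and t :: "'z \<Rightarrow> 'a word set \<Rightarrow> 'z"
  assumes q: "q ` carrier Z = carrier X"
    and tc: "\<And>z k. \<lbrakk>z \<in> carrier Z; k \<in> H\<rbrakk> \<Longrightarrow> t z k \<in> carrier Z"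
    and tq: "\<And>z k. \<lbrakk>z \<in> carrier Z; k \<in> H\<rbrakk> \<Longrightarrow> q (t z k) = pth_act X (q z) k"
    and t1: "\<And>z. z \<in> carrier Z \<Longrightarrow> t z \<one>\<^bsub>Pth X\<^esub> = z"
    and tm: "\<And>z k l. \<lbrakk>z \<in> carrier Z; k \<in> H; l \<in> H\<rbrakk> \<Longrightarrow> t z (k \<otimes>\<^bsub>Pth X\<^esub> l) = t (t z k) l"
    and r: "\<And>z z'. \<lbrakk>z \<in> carrier Z; z' \<in> carrier Z\<rbrakk> \<Longrightarrow> z \<triangleleft>\<^bsub>Z\<^esub> z' = t z (\<delta> (q z) (q z'))"
    and z: "z \<in> carrier Z"
  shows "(z, z') \<in> conn Z \<longleftrightarrow> (\<exists>k\<in>H. z' = t z k)"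
proof
  have qc: "q z \<in> carrier X" if "z \<in> carrier Z" for z using q that by blast
  let ?R = "{(a, a \<triangleleft>\<^bsub>Z\<^esub> b) | a b. a \<in> carrier Z \<and> b \<in> carrier Z}"
  have R: "(\<exists>k\<in>H. v = t u k) \<and> (\<exists>k\<in>H. u = t v k)" if uv: "(u, v) \<in> ?R" for u v
  proof -
    obtain b where b: "u \<in> carrier Z" "b \<in> carrier Z" "v = u \<triangleleft>\<^bsub>Z\<^esub> b" using uv by blast
    let ?d = "\<delta> (q u) (q b)"
    have d: "?d \<in> H" using b qc by (simp add: delta_closed)
    have v: "v = t u ?d" using b by (simp add: r)
    have "u = t v (inv\<^bsub>Pth X\<^esub> ?d)" unfolding v using b d by (simp add: t1 flip: tm)
    with d v show ?thesis by blast
  qed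
  assume "(z, z') \<in> conn Z"
  then have "(z, z') \<in> (?R \<union> ?R\<inverse>)\<^sup>*" by (simp add: conn_def)
  then show "\<exists>k\<in>H. z' = t z k"
  proof (induction rule: rtrancl_induct)
    case base
    show ?case using t1 [OF z] by force
  next
    case (step u v)
    then obtain k where k: "k \<in> H" "u = t z k" by blast
    obtain l where "l \<in> H" "v = t u l" using step.hyps(2) R [of u v] R [of v u] by blast
    then show ?case using k z tm [of z k l] by (metis H_closed(3))
  qed
next
  have qc: "q z \<in> carrier X" using q z by blast
  assume "\<exists>k\<in>H. z' = t z k"
  then obtain k where k: "k \<in> H" "z' = t z k" by blast
  have "(z, t z k) \<in> conn Z"
  proof (rule delta_induct [OF qc k(1)])
    show "(z, t z \<one>\<^bsub>Pth X\<^esub>) \<in> conn Z" using z by (simp add: t1 conn_def)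
  next
    fix k y assume k: "k \<in> H" and y: "y \<in> carrier X"
    obtain b where b: "b \<in> carrier Z" "y = q b" using q y by blast
    let ?d = "\<delta> (pth_act X (q z) k) y"
    have d: "?d \<in> H" using qc y k by (simp add: delta_closed)
    have "t z (k \<otimes>\<^bsub>Pth X\<^esub> ?d) = t z k \<triangleleft>\<^bsub>Z\<^esub> b"
      using z k b d by (simp add: tm r tc tq)
    moreover have "t z k \<in> carrier Z" "t z (k \<otimes>\<^bsub>Pth X\<^esub> ?d) \<in> carrier Z"
      using z k d by (simp_all add: tc)
    ultimately have "(t z k, t z (k \<otimes>\<^bsub>Pth X\<^esub> ?d)) \<in> conn Z"
      unfolding conn_def using b(1) by blast
    then show "(z, t z k) \<in> conn Z \<longleftrightarrow> (z, t z (k \<otimes>\<^bsub>Pth X\<^esub> ?d)) \<in> conn Z"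
      using equiv_conn [of Z] by (meson equivE symE transE)
  qed
  then show "(z, z') \<in> conn Z" using k by simp
qed

lemma complete_invariant_orbits:
  fixes Z :: "'z rack" and q :: "'z \<Rightarrow> 'a" and t :: "'z \<Rightarrow> 'a word set \<Rightarrow> 'z"
  assumes q: "q ` carrier Z = carrier X"
    and tc: "\<And>z k. \<lbrakk>z \<in> carrier Z; k \<in> H\<rbrakk> \<Longrightarrow> t z k \<in> carrier Z"
    and tq: "\<And>z k. \<lbrakk>z \<in> carrier Z; k \<in> H\<rbrakk> \<Longrightarrow> q (t z k) = pth_act X (q z) k"
    and t1: "\<And>z. z \<in> carrier Z \<Longrightarrow> t z \<one>\<^bsub>Pth X\<^esub> = z"
    and tm: "\<And>z k l. \<lbrakk>z \<in> carrier Z; k \<in> H; l \<in> H\<rbrakk> \<Longrightarrow> t z (k \<otimes>\<^bsub>Pth X\<^esub> l) = t (t z k) l"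
    and r: "\<And>z z'. \<lbrakk>z \<in> carrier Z; z' \<in> carrier Z\<rbrakk> \<Longrightarrow> z \<triangleleft>\<^bsub>Z\<^esub> z' = t z (\<delta> (q z) (q z'))"
    and S: "\<kappa> ` carrier Z = S"
    and inv: "\<And>z k. \<lbrakk>z \<in> carrier Z; k \<in> H\<rbrakk> \<Longrightarrow> \<kappa> (t z k) = \<kappa> z"
    and sep: "\<And>z z'. \<lbrakk>z \<in> carrier Z; z' \<in> carrier Z; \<kappa> z = \<kappa> z'\<rbrakk> \<Longrightarrow> \<exists>k\<in>H. z' = t z k"
  shows "complete_invariant Z \<kappa> S"
  unfolding complete_invariant_def using S sep inv by (auto simp: conn_orbits [OF q tc tq t1 tm r])

definition translate :: "'a cov \<Rightarrow> 'a word set \<Rightarrow> 'a cov" where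
  "translate u k = (fst u, snd u \<otimes>\<^bsub>Pth X\<^esub> k)"

text \<open>The quotient \<open>g h\<inverse>\<close> does not change when \<open>g\<close> and \<open>h\<close> are translated by the same
  element, and it carries \<open>a\<close> to \<open>b\<close> whenever \<open>a \<cdot> g = b \<cdot> h\<close>.\<close>
definition arr_invariant :: "'a cov \<times> 'a cov \<Rightarrow> 'a \<times> 'a word set" where
  "arr_invariant = (\<lambda>((a, g), (b, h)). (a, g \<otimes>\<^bsub>Pth X\<^esub> inv\<^bsub>Pth X\<^esub> h))"

lemma omega_apply: "omega X (a, g) = pth_act X a g"
  by (simp add: omega_def)

lemma omega_closed: "u \<in> carrier X' \<Longrightarrow> omega X u \<in> carrier X"
  by (auto simp: carrier_X' omega_apply)

lemma omega_image: "omega X ` carrier X' = carrier X"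
proof -
  have "a \<in> omega X ` carrier X'" if "a \<in> carrier X" for a
    using that by (intro image_eqI [of _ _ "(a, \<one>\<^bsub>Pth X\<^esub>)"])
      (auto simp: carrier_X' omega_apply pth_act_one)
  then show ?thesis using omega_closed by blast
qed

lemma translate_one: "u \<in> carrier X' \<Longrightarrow> translate u \<one>\<^bsub>Pth X\<^esub> = u"
  by (auto simp: translate_def carrier_X')

lemma fst_translate: "fst (translate u k) = fst u"
  by (simp add: translate_def)

lemma translate_simps:
  assumes "u \<in> carrier X'" "k \<in> H"
  shows "translate u k \<in> carrier X'"
    and "omega X (translate u k) = pth_act X (omega X u) k"
    and "l \<in> H \<Longrightarrow> translate u (k \<otimes>\<^bsub>Pth X\<^esub> l) = translate (translate u k) l"
  using assms by (auto simp: translate_def carrier_X' omega_apply pth_act_mult P.m_assoc)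

lemma rop_translate:
  "\<lbrakk>u \<in> carrier X'; v \<in> carrier X'\<rbrakk> \<Longrightarrow> u \<triangleleft>\<^bsub>X'\<^esub> v = translate u (\<delta> (omega X u) (omega X v))"
  by (simp add: rop_X' translate_def)

lemma translate_connects:
  assumes "u \<in> carrier X'" "v \<in> carrier X'" "fst u = fst v"
  shows "inv\<^bsub>Pth X\<^esub> snd u \<otimes>\<^bsub>Pth X\<^esub> snd v \<in> H"
    and "translate u (inv\<^bsub>Pth X\<^esub> snd u \<otimes>\<^bsub>Pth X\<^esub> snd v) = v"
  using assms by (auto simp: translate_def carrier_X' P_cancel)

lemma arr_invariant_translate:
  assumes "u \<in> carrier X'" "v \<in> carrier X'" "k \<in> H"
  shows "arr_invariant (translate u k, translate v k) = arr_invariant (u, v)"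
  using assms by (auto simp: translate_def carrier_X' arr_invariant_def P.inv_mult_group P.m_assoc P_cancel)

lemma arr_invariant_cod:
  assumes "u \<in> carrier X'" "v \<in> carrier X'" "omega X u = omega X v"
  shows "pth_act X (fst (arr_invariant (u, v))) (snd (arr_invariant (u, v))) = fst v"
  using assms by (auto simp: carrier_X' omega_apply arr_invariant_def pth_act_mult pth_act_inv)

text \<open>Two pairs with the same invariant differ by a common translation: the element that
  carries \<open>u\<close> to \<open>u'\<close> is also the one that carries \<open>v\<close> to \<open>v'\<close>. The equation of the second
  entries of the invariants, multiplied by \<open>g\<inverse>\<close> on the left and by \<open>h'\<close> on the right, is
  the last claim.\<close>
lemma arr_invariant_inj:
  assumes "u \<in> carrier X'" "v \<in> carrier X'" "u' \<in> carrier X'" "v' \<in> carrier X'"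
    and "omega X u = omega X v" "omega X u' = omega X v'"
    and e: "arr_invariant (u, v) = arr_invariant (u', v')"
  shows "fst u' = fst u" "fst v' = fst v"
    and "inv\<^bsub>Pth X\<^esub> snd v \<otimes>\<^bsub>Pth X\<^esub> snd v' = inv\<^bsub>Pth X\<^esub> snd u \<otimes>\<^bsub>Pth X\<^esub> snd u'"
proof -
  show "fst v' = fst v" using assms arr_invariant_cod by metis
  show "fst u' = fst u" using e by (auto simp: arr_invariant_def split: prod.splits)
  obtain a g b h where u: "u = (a, g)" "v = (b, h)" by fastforce
  obtain a' g' b' h' where u': "u' = (a', g')" "v' = (b', h')" by fastforce
  have c: "g \<in> H" "g' \<in> H" "h \<in> H" "h' \<in> H" using assms u u' by (auto simp: carrier_X')
  have "g \<otimes>\<^bsub>Pth X\<^esub> inv\<^bsub>Pth X\<^esub> h = g' \<otimes>\<^bsub>Pth X\<^esub> inv\<^bsub>Pth X\<^esub> h'"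
    using e u u' by (simp add: arr_invariant_def)
  then have "inv\<^bsub>Pth X\<^esub> g \<otimes>\<^bsub>Pth X\<^esub> (g \<otimes>\<^bsub>Pth X\<^esub> inv\<^bsub>Pth X\<^esub> h) \<otimes>\<^bsub>Pth X\<^esub> h'
      = inv\<^bsub>Pth X\<^esub> g \<otimes>\<^bsub>Pth X\<^esub> (g' \<otimes>\<^bsub>Pth X\<^esub> inv\<^bsub>Pth X\<^esub> h') \<otimes>\<^bsub>Pth X\<^esub> h'" by simp
  then show "inv\<^bsub>Pth X\<^esub> snd v \<otimes>\<^bsub>Pth X\<^esub> snd v' = inv\<^bsub>Pth X\<^esub> snd u \<otimes>\<^bsub>Pth X\<^esub> snd u'"
    using c u u' by (simp add: P_cancel) (simp add: P.m_assoc)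
qed

lemma obj_complete: "complete_invariant X' fst (carrier X)"
proof (rule complete_invariant_orbits [where q = "omega X" and t = translate])
  show "fst ` carrier X' = carrier X" by (force simp: carrier_X')
  show "\<exists>k\<in>H. z' = translate z k"
    if "z \<in> carrier X'" "z' \<in> carrier X'" "fst z = fst z'" for z z'
    using translate_connects [OF that] by metis
qed (auto simp: translate_simps translate_one fst_translate rop_translate omega_image)

lemma carrier_arr:
  "carrier (iarr ker_pair) = {(u, v). u \<in> carrier X' \<and> v \<in> carrier X' \<and> omega X u = omega X v}"
  by (simp add: kernel_pair_def)

lemma rop_arr: "(u, v) \<triangleleft>\<^bsub>iarr ker_pair\<^esub> (u', v') = (u \<triangleleft>\<^bsub>X'\<^esub> u', v \<triangleleft>\<^bsub>X'\<^esub> v')"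
  by (simp add: kernel_pair_def)

lemma carrier_comp:
  "carrier (composables ker_pair) = {((u, v), (v', w)). v' = v \<and> u \<in> carrier X' \<and> v \<in> carrier X'
     \<and> w \<in> carrier X' \<and> omega X u = omega X v \<and> omega X v = omega X w}"
  by (auto simp: composables_def carrier_arr) (auto simp: kernel_pair_def)

lemma rop_comp: "(p, q) \<triangleleft>\<^bsub>composables ker_pair\<^esub> (p', q') = (p \<triangleleft>\<^bsub>iarr ker_pair\<^esub> p', q \<triangleleft>\<^bsub>iarr ker_pair\<^esub> q')"
  by (simp add: composables_def)

definition arrow :: "'a \<Rightarrow> 'a word set \<Rightarrow> 'a cov \<times> 'a cov" where
  "arrow a k = ((a, k), (pth_act X a k, \<one>\<^bsub>Pth X\<^esub>))"

lemma arrow: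
  assumes "a \<in> carrier X" "k \<in> H"
  shows "arrow a k \<in> carrier (iarr ker_pair)" "arr_invariant (arrow a k) = (a, k)"
  using assms by (auto simp: arrow_def carrier_arr carrier_X' omega_apply pth_act_one arr_invariant_def)

lemma arr_invariant_closed:
  "p \<in> carrier (iarr ker_pair) \<Longrightarrow> arr_invariant p \<in> carrier X \<times> H"
  by (auto simp: carrier_arr carrier_X' arr_invariant_def)

text \<open>Hence a component of the kernel pair is the same thing as an arrow of the action
  groupoid.\<close>
lemma arr_complete: "complete_invariant (iarr ker_pair) arr_invariant (carrier X \<times> H)"
proof (rule complete_invariant_orbits [where q = "\<lambda>(u, v). omega X u"
      and t = "\<lambda>(u, v) k. (translate u k, translate v k)"])
  show "(\<lambda>(u, v). omega X u) ` carrier (iarr ker_pair) = carrier X"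
    using omega_image by (force simp: carrier_arr)
  show "arr_invariant ` carrier (iarr ker_pair) = carrier X \<times> H"
  proof
    show "carrier X \<times> H \<subseteq> arr_invariant ` carrier (iarr ker_pair)"
    proof
      fix p assume "p \<in> carrier X \<times> H"
      then show "p \<in> arr_invariant ` carrier (iarr ker_pair)"
        by (intro image_eqI [of _ _ "arrow (fst p) (snd p)"]) (auto simp: arrow)
    qed
  qed (use arr_invariant_closed in blast)
  fix z z' assume z: "z \<in> carrier (iarr ker_pair)" "z' \<in> carrier (iarr ker_pair)"
    "arr_invariant z = arr_invariant z'"
  obtain u v u' v' where e: "z = (u, v)" "z' = (u', v')" by (metis surj_pair)
  have c: "u \<in> carrier X'" "v \<in> carrier X'" "u' \<in> carrier X'" "v' \<in> carrier X'"
    "omega X u = omega X v" "omega X u' = omega X v'"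
    using z e by (auto simp: carrier_arr)
  note i = arr_invariant_inj [OF c z(3) [unfolded e]]
  show "\<exists>k\<in>H. z' = (case z of (u, v) \<Rightarrow> \<lambda>k. (translate u k, translate v k)) k"
    using translate_connects [OF c(1,3) i(1) [symmetric]]
      translate_connects [OF c(2,4) i(2) [symmetric]] i(3) e
    by (intro bexI [of _ "inv\<^bsub>Pth X\<^esub> snd u \<otimes>\<^bsub>Pth X\<^esub> snd u'"]) auto
qed (auto simp: carrier_arr rop_arr translate_simps translate_one rop_translate arr_invariant_translate)

text \<open>A composable pair of arrows \<open>(a, k)\<close> and \<open>(a \<cdot> k, l)\<close> is realised over the single point
  \<open>a \<cdot> k \<cdot> l\<close> of \<open>X\<close>, by three elements with path components \<open>k \<otimes> l\<close>, \<open>l\<close> and the unit. So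
  the components of the composable pairs are the composable pairs of the action groupoid.\<close>
lemma comp_complete:
  "complete_invariant (composables ker_pair) (map_prod arr_invariant arr_invariant)
     {(p, q). p \<in> carrier X \<times> H \<and> q \<in> carrier X \<times> H \<and> pth_act X (fst p) (snd p) = fst q}"
    (is "complete_invariant _ _ ?S")
proof (rule complete_invariant_orbits [where q = "\<lambda>((u, v), (v', w)). omega X u"
      and t = "\<lambda>((u, v), (v', w)) k. ((translate u k, translate v k), (translate v' k, translate w k))"])
  show "(\<lambda>((u, v), (v', w)). omega X u) ` carrier (composables ker_pair) = carrier X"
  proof (intro equalityI subsetI)
    fix a assume "a \<in> carrier X"
    then obtain u where "u \<in> carrier X'" "a = omega X u" using omega_image by blast
    then show "a \<in> (\<lambda>((u, v), (v', w)). omega X u) ` carrier (composables ker_pair)"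
      by (intro image_eqI [of _ _ "((u, u), (u, u))"]) (auto simp: carrier_comp)
  qed (auto simp: carrier_comp omega_closed)
  show "map_prod arr_invariant arr_invariant ` carrier (composables ker_pair) = ?S"
  proof
    show "?S \<subseteq> map_prod arr_invariant arr_invariant ` carrier (composables ker_pair)"
    proof
      fix s assume "s \<in> ?S"
      then obtain a k l where s: "s = ((a, k), (pth_act X a k, l))" "a \<in> carrier X" "k \<in> H" "l \<in> H"
        by auto
      let ?b = "pth_act X a k"
      let ?z = "(((a, k \<otimes>\<^bsub>Pth X\<^esub> l), (?b, l)), ((?b, l), (pth_act X ?b l, \<one>\<^bsub>Pth X\<^esub>)))"
      have "?z \<in> carrier (composables ker_pair)"
        using s by (simp add: carrier_comp carrier_X' omega_apply pth_act_mult pth_act_one)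
      moreover have "map_prod arr_invariant arr_invariant ?z = s"
        using s by (simp add: arr_invariant_def P.m_assoc)
      ultimately show "s \<in> map_prod arr_invariant arr_invariant ` carrier (composables ker_pair)" by force
    qed
    show "map_prod arr_invariant arr_invariant ` carrier (composables ker_pair) \<subseteq> ?S"
    proof (rule image_subsetI)
      fix z assume "z \<in> carrier (composables ker_pair)"
      then obtain u v w where z: "z = ((u, v), (v, w))"
        and c: "u \<in> carrier X'" "v \<in> carrier X'" "w \<in> carrier X'"
          "omega X u = omega X v" "omega X v = omega X w"
        by (auto simp: carrier_comp)
      have "arr_invariant (u, v) \<in> carrier X \<times> H" "arr_invariant (v, w) \<in> carrier X \<times> H"
        using c by (simp_all add: arr_invariant_closed carrier_arr)
      moreover have "fst (arr_invariant (v, w)) = fst v"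
        by (simp add: arr_invariant_def case_prod_beta)
      ultimately show "map_prod arr_invariant arr_invariant z \<in> ?S"
        using arr_invariant_cod [OF c(1,2,4)] by (simp add: z)
    qed
  qed
  fix z z' assume z: "z \<in> carrier (composables ker_pair)" "z' \<in> carrier (composables ker_pair)"
    "map_prod arr_invariant arr_invariant z = map_prod arr_invariant arr_invariant z'"
  obtain u v w u' v' w' where e: "z = ((u, v), (v, w))" "z' = ((u', v'), (v', w'))"
    using z by (auto simp: carrier_comp)
  have c: "u \<in> carrier X'" "v \<in> carrier X'" "w \<in> carrier X'"
    "u' \<in> carrier X'" "v' \<in> carrier X'" "w' \<in> carrier X'"
    "omega X u = omega X v" "omega X u' = omega X v'" "omega X v = omega X w" "omega X v' = omega X w'"
    and k: "arr_invariant (u, v) = arr_invariant (u', v')" "arr_invariant (v, w) = arr_invariant (v', w')"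
    using z e by (auto simp: carrier_comp)
  note i = arr_invariant_inj [OF c(1,2,4,5,7,8) k(1)]
  note j = arr_invariant_inj [OF c(2,3,5,6,9,10) k(2)]
  show "\<exists>k\<in>H. z' = (case z of (p, q) \<Rightarrow> (case p of (u, v) \<Rightarrow> \<lambda>(v', w) k.
      ((translate u k, translate v k), (translate v' k, translate w k))) q) k"
    using translate_connects [OF c(1,4) i(1) [symmetric]]
      translate_connects [OF c(2,5) i(2) [symmetric]]
      translate_connects [OF c(3,6) j(2) [symmetric]] i(3) j(3) e
    by (intro bexI [of _ "inv\<^bsub>Pth X\<^esub> snd u \<otimes>\<^bsub>Pth X\<^esub> snd u'"]) auto
qed (auto simp: carrier_comp rop_comp rop_arr translate_simps translate_one rop_translate arr_invariant_translate)

lemma can_obj_class: "u \<in> carrier X' \<Longrightarrow> can_obj (conn X' `` {u}) = fst u"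
  unfolding can_obj_def by (rule complete_invariant_the_elem [OF obj_complete])

lemma can_arr_class: "p \<in> carrier (iarr ker_pair) \<Longrightarrow> can_arr X (conn (iarr ker_pair) `` {p}) = arr_invariant p"
  unfolding can_arr_def arr_invariant_def [symmetric]
  by (rule complete_invariant_the_elem [OF arr_complete])

lemma can_obj_bij: "bij_betw can_obj (pi0 X') (carrier X)"
  using complete_invariant_bij [OF obj_complete] by (simp add: can_obj_def [abs_def])

lemma can_arr_bij: "bij_betw (can_arr X) (pi0 (iarr ker_pair)) (carrier X \<times> H)"
  using complete_invariant_bij [OF arr_complete]
  by (simp add: can_arr_def [abs_def] arr_invariant_def)

lemma structure_homs:
  "fst \<in> rack_hom (iarr ker_pair) X'" "snd \<in> rack_hom (iarr ker_pair) X'"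
  "(\<lambda>u. (u, u)) \<in> rack_hom X' (iarr ker_pair)" "(\<lambda>(u, v). (v, u)) \<in> rack_hom (iarr ker_pair) (iarr ker_pair)"
  "fst \<in> rack_hom (composables ker_pair) (iarr ker_pair)" "snd \<in> rack_hom (composables ker_pair) (iarr ker_pair)"
  "icmp ker_pair \<in> rack_hom (composables ker_pair) (iarr ker_pair)"
  by (auto simp: rack_hom_def carrier_arr rop_arr carrier_comp rop_comp)
     (auto simp: kernel_pair_def)

lemma can_obj_dm:
  assumes "C \<in> pi0 (iarr ker_pair)"
  shows "can_obj (pi0_map X' fst C) = fst (can_arr X C)"
    and "can_obj (pi0_map X' snd C) = pth_act X (fst (can_arr X C)) (snd (can_arr X C))"
proof -
  obtain u v where z: "(u, v) \<in> carrier (iarr ker_pair)" "C = conn (iarr ker_pair) `` {(u, v)}"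
    using assms by (metis pi0_cases surj_pair)
  then have c: "u \<in> carrier X'" "v \<in> carrier X'" "omega X u = omega X v" by (auto simp: carrier_arr)
  show "can_obj (pi0_map X' fst C) = fst (can_arr X C)"
    using z c by (simp add: pi0_map_class [OF structure_homs(1)] can_obj_class can_arr_class)
      (simp add: arr_invariant_def split: prod.split)
  show "can_obj (pi0_map X' snd C) = pth_act X (fst (can_arr X C)) (snd (can_arr X C))"
    using z c by (simp add: pi0_map_class [OF structure_homs(2)] can_obj_class can_arr_class
        arr_invariant_cod)
qed

text \<open>The pullback that the comparison map of \<open>pi0_compare\<close> has to hit.\<close>
definition comp_pairs where
  "comp_pairs = {(C, D). C \<in> pi0 (iarr ker_pair) \<and> D \<in> pi0 (iarr ker_pair)
          \<and> pi0_map X' snd C = pi0_map X' fst D}"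

text \<open>As \<open>can_obj\<close> is injective, the condition on codomain and domain can be read in the
  action groupoid.\<close>
lemma comp_pairs_bij:
  "bij_betw (map_prod (can_arr X) (can_arr X)) comp_pairs
    {(p, q). p \<in> carrier X \<times> H \<and> q \<in> carrier X \<times> H \<and> pth_act X (fst p) (snd p) = fst q}"
    (is "bij_betw _ _ ?S")
proof -
  have eq: "pi0_map X' snd C = pi0_map X' fst D \<longleftrightarrow>
      pth_act X (fst (can_arr X C)) (snd (can_arr X C)) = fst (can_arr X D)"
    if "C \<in> pi0 (iarr ker_pair)" "D \<in> pi0 (iarr ker_pair)" for C D
    using that can_obj_dm [of C] can_obj_dm [of D] can_obj_bij
      pi0_map_closed [OF structure_homs(1), of D] pi0_map_closed [OF structure_homs(2), of C]
    by (metis bij_betw_def inj_onD)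
  have inj: "inj_on (map_prod (can_arr X) (can_arr X)) comp_pairs"
    using can_arr_bij by (auto simp: comp_pairs_def bij_betw_def inj_on_def)
  have "map_prod (can_arr X) (can_arr X) ` comp_pairs = ?S"
  proof
    show "map_prod (can_arr X) (can_arr X) ` comp_pairs \<subseteq> ?S"
    proof (rule image_subsetI)
      fix c assume "c \<in> comp_pairs"
      then obtain C D where c: "c = (C, D)" "C \<in> pi0 (iarr ker_pair)" "D \<in> pi0 (iarr ker_pair)"
        "pi0_map X' snd C = pi0_map X' fst D"
        by (auto simp: comp_pairs_def)
      then have "can_arr X C \<in> carrier X \<times> H" "can_arr X D \<in> carrier X \<times> H"
        using can_arr_bij by (auto simp: bij_betw_def)
      then show "map_prod (can_arr X) (can_arr X) c \<in> ?S"
        using eq [of C D] c by simp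
    qed
    show "?S \<subseteq> map_prod (can_arr X) (can_arr X) ` comp_pairs"
    proof
      fix s assume "s \<in> ?S"
      then obtain p q where s: "s = (p, q)" "p \<in> carrier X \<times> H" "q \<in> carrier X \<times> H"
        "pth_act X (fst p) (snd p) = fst q"
        by blast
      then obtain C D where "C \<in> pi0 (iarr ker_pair)" "D \<in> pi0 (iarr ker_pair)"
        "p = can_arr X C" "q = can_arr X D"
        using bij_betw_imp_surj_on [OF can_arr_bij] by blast
      then show "s \<in> map_prod (can_arr X) (can_arr X) ` comp_pairs"
        using eq [of C D] s by (intro image_eqI [of _ _ "(C, D)"]) (auto simp: comp_pairs_def)
    qed
  qed
  with inj show ?thesis by (simp add: bij_betw_def)
qed

lemma compare_class:
  assumes "z \<in> carrier (composables ker_pair)"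
  shows "pi0_compare ker_pair (conn (composables ker_pair) `` {z})
    = (conn (iarr ker_pair) `` {fst z}, conn (iarr ker_pair) `` {snd z})"
  using assms by (simp add: pi0_compare_def pi0_map_class [OF structure_homs(5)]
      pi0_map_class [OF structure_homs(6)])

text \<open>A left adjoint such as \<open>\<pi>\<^sub>0\<close> need not preserve pullbacks. It does so here because both
  sides of the comparison are classified by the composable pairs of the action groupoid, and
  the comparison commutes with the two classifications.\<close>
lemma compare_bij: "bij_betw (pi0_compare ker_pair) (pi0 (composables ker_pair)) comp_pairs"
proof -
  let ?\<kappa> = "map_prod arr_invariant arr_invariant" and ?can = "map_prod (can_arr X) (can_arr X)"
  have eq: "?can (pi0_compare ker_pair C) = the_elem (?\<kappa> ` C)" if "C \<in> pi0 (composables ker_pair)" for C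
    using that
  proof (rule pi0_cases)
    fix z assume z: "z \<in> carrier (composables ker_pair)" "C = conn (composables ker_pair) `` {z}"
    then have "fst z \<in> carrier (iarr ker_pair)" "snd z \<in> carrier (iarr ker_pair)"
      by (auto simp: carrier_comp carrier_arr)
    then have "?can (pi0_compare ker_pair C) = ?\<kappa> z"
      using z by (cases z) (simp add: compare_class can_arr_class)
    then show ?thesis
      using z by (simp only: complete_invariant_the_elem [OF comp_complete])
  qed
  have "pi0_compare ker_pair \<in> pi0 (composables ker_pair) \<rightarrow> comp_pairs"
  proof
    fix C assume "C \<in> pi0 (composables ker_pair)"
    then obtain z where z: "z \<in> carrier (composables ker_pair)" "C = conn (composables ker_pair) `` {z}"
      by (rule pi0_cases)
    then show "pi0_compare ker_pair C \<in> comp_pairs"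
      by (auto simp: compare_class comp_pairs_def carrier_comp carrier_arr pi0_class
          pi0_map_class [OF structure_homs(1)] pi0_map_class [OF structure_homs(2)])
  qed
  moreover have "bij_betw (?can \<circ> pi0_compare ker_pair) (pi0 (composables ker_pair))
    {(p, q). p \<in> carrier X \<times> H \<and> q \<in> carrier X \<times> H \<and> pth_act X (fst p) (snd p) = fst q}"
    using complete_invariant_bij [OF comp_complete] by (rule bij_betw_cong [THEN iffD1, rotated]) (simp add: eq)
  ultimately show ?thesis
    using comp_pairs_bij bij_betw_comp_iff2 [of ?can comp_pairs _ "pi0_compare ker_pair" "pi0 (composables ker_pair)"]
    by blast
qed

lemma preserves_composables: "pi0_preserves_composables ker_pair"
  using compare_bij unfolding pi0_preserves_composables_def comp_pairs_def
  by (simp add: kernel_pair_def)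

lemma pi0_cmp:
  assumes "z \<in> carrier (composables ker_pair)"
  shows "cmp (pi0_gpd ker_pair) (conn (iarr ker_pair) `` {fst z}) (conn (iarr ker_pair) `` {snd z})
    = conn (iarr ker_pair) `` {icmp ker_pair z}"
  using assms compare_bij unfolding pi0_gpd_def
  by (simp add: bij_betw_def pi0_class pi0_map_class [OF structure_homs(7)] flip: compare_class)

lemma group_H: "group ((Pth X)\<lparr>carrier := H\<rparr>)"
  by (rule subgroup.subgroup_is_group [OF subgroup_H P.is_group])

lemma groupoid_action: "groupoid act_gpd"
  by (rule groupoid_action_gpd [OF group_H]) (auto simp: pth_act_one pth_act_mult)

theorem pi0_groupoid_iso: "groupoid_iso (pi0_gpd ker_pair) act_gpd can_obj (can_arr X)"
proof (rule groupoid_iso_transport [OF groupoid_action])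
  have ker_pair_sel: "iobj ker_pair = X'" "idm ker_pair = fst" "icd ker_pair = snd" "iidn ker_pair = (\<lambda>u. (u, u))"
    "iivs ker_pair = (\<lambda>(u, v). (v, u))" by (simp_all add: kernel_pair_def)
  note sel = pi0_gpd_def action_gpd_def ker_pair_sel
  show "bij_betw can_obj (Obj (pi0_gpd ker_pair)) (Obj act_gpd)" by (simp add: sel can_obj_bij)
  show "bij_betw (can_arr X) (Arr (pi0_gpd ker_pair)) (Arr act_gpd)"
    using can_arr_bij by (simp add: pi0_gpd_def action_gpd_def)
  show "dm (pi0_gpd ker_pair) C \<in> Obj (pi0_gpd ker_pair) \<and> can_obj (dm (pi0_gpd ker_pair) C) = dm act_gpd (can_arr X C)"
    "cd (pi0_gpd ker_pair) C \<in> Obj (pi0_gpd ker_pair) \<and> can_obj (cd (pi0_gpd ker_pair) C) = cd act_gpd (can_arr X C)"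
    if "C \<in> Arr (pi0_gpd ker_pair)" for C
    using that pi0_map_closed [OF structure_homs(1)] pi0_map_closed [OF structure_homs(2)]
    by (simp_all add: sel can_obj_dm case_prod_beta)
  show "idn (pi0_gpd ker_pair) C \<in> Arr (pi0_gpd ker_pair) \<and> can_arr X (idn (pi0_gpd ker_pair) C) = idn act_gpd (can_obj C)"
    if C: "C \<in> Obj (pi0_gpd ker_pair)" for C
  proof -
    from C have "C \<in> pi0 X'" by (simp add: sel)
    then obtain a g where z: "(a, g) \<in> carrier X'" "C = conn X' `` {(a, g)}"
      by (metis pi0_cases surj_pair)
    then have "((a, g), (a, g)) \<in> carrier (iarr ker_pair)" by (simp add: carrier_arr)
    then show ?thesis
      using z by (auto simp: sel pi0_map_class [OF structure_homs(3)] can_arr_class can_obj_class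
          pi0_class arr_invariant_def carrier_X')
  qed
  show "ivs (pi0_gpd ker_pair) C \<in> Arr (pi0_gpd ker_pair) \<and> can_arr X (ivs (pi0_gpd ker_pair) C) = ivs act_gpd (can_arr X C)"
    if C: "C \<in> Arr (pi0_gpd ker_pair)" for C
  proof -
    from C have "C \<in> pi0 (iarr ker_pair)" by (simp add: pi0_gpd_def)
    then obtain u v where z: "(u, v) \<in> carrier (iarr ker_pair)" "C = conn (iarr ker_pair) `` {(u, v)}"
      by (metis pi0_cases surj_pair)
    then have vu: "(v, u) \<in> carrier (iarr ker_pair)" by (auto simp: carrier_arr)
    have "arr_invariant (v, u) = ivs act_gpd (arr_invariant (u, v))"
    proof -
      obtain a g b h where e: "u = (a, g)" "v = (b, h)" by fastforce
      have c: "g \<in> H" "h \<in> H" "u \<in> carrier X'" "v \<in> carrier X'" "omega X u = omega X v"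
        using z e by (auto simp: carrier_arr carrier_X')
      have "inv\<^bsub>(Pth X)\<lparr>carrier := H\<rparr>\<^esub> k = inv\<^bsub>Pth X\<^esub> k" if "k \<in> H" for k
        using P.m_inv_consistent [OF subgroup_H that] by simp
      then show ?thesis using arr_invariant_cod [OF c(3-5)] e c
        by (simp add: action_gpd_def arr_invariant_def P.inv_mult_group)
    qed
    then show ?thesis
      using z vu pi0_class [OF vu]
      by (simp add: pi0_gpd_def ker_pair_sel pi0_map_class [OF structure_homs(4)] can_arr_class)
  qed
  show "cmp (pi0_gpd ker_pair) C D \<in> Arr (pi0_gpd ker_pair)
      \<and> can_arr X (cmp (pi0_gpd ker_pair) C D) = cmp act_gpd (can_arr X C) (can_arr X D)"
    if "C \<in> Arr (pi0_gpd ker_pair)" "D \<in> Arr (pi0_gpd ker_pair)" "cd (pi0_gpd ker_pair) C = dm (pi0_gpd ker_pair) D" for C D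
  proof -
    have "(C, D) \<in> pi0_compare ker_pair ` pi0 (composables ker_pair)"
      using that compare_bij by (simp add: bij_betw_def comp_pairs_def sel)
    then obtain z where z: "z \<in> carrier (composables ker_pair)"
      "C = conn (iarr ker_pair) `` {fst z}" "D = conn (iarr ker_pair) `` {snd z}"
      by (auto simp: compare_class elim!: pi0_cases)
    then obtain u v w where e: "z = ((u, v), (v, w))" by (auto simp: carrier_comp)
    have i: "icmp ker_pair z = (u, w)" by (simp add: e kernel_pair_def)
    have m: "(u, v) \<in> carrier (iarr ker_pair)" "(v, w) \<in> carrier (iarr ker_pair)" "(u, w) \<in> carrier (iarr ker_pair)"
      using z e by (auto simp: carrier_comp carrier_arr)
    have "arr_invariant (u, w) = cmp act_gpd (arr_invariant (u, v)) (arr_invariant (v, w))"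
      using m by (auto simp: carrier_arr carrier_X' arr_invariant_def action_gpd_def P.m_assoc P_cancel)
    then show ?thesis
      using pi0_cmp [OF z(1)] m pi0_class [OF m(3)] z e i by (simp add: can_arr_class) (simp add: pi0_gpd_def)
  qed
qed

end

section \<open>Naturality\<close>

text \<open>The induction is over the path, and translation by \<open>f y\<close> is injective in \<open>Y\<close>. This makes
  the claims for \<open>k\<close> and for \<open>k \<otimes> gen y\<close> equivalent.\<close>
lemma pth_act_map:
  assumes "rack X" "rack Y" and f: "f \<in> rack_hom X Y"
    and "k \<in> carrier (Pth X)" and a: "a \<in> carrier X"
  shows "pth_act Y (f a) (pth_map Y f k) = f (pth_act X a k)"
proof -
  interpret X: rack X by fact
  interpret Y: rack Y by fact
  have fc: "f x \<in> carrier Y" if "x \<in> carrier X" for x using f that by (auto simp: rack_hom_def)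
  have fr: "f (rop X x y) = rop Y (f x) (f y)" if "x \<in> carrier X" "y \<in> carrier X" for x y
    using f that by (auto simp: rack_hom_def)
  have m: "pth_map Y f k \<in> carrier (Pth Y)" if "k \<in> carrier (Pth X)" for k
    using hom_in_carrier [OF pth_map_hom [OF f] that] .
  from assms(4) show ?thesis
  proof (induction rule: X.Pth_induct)
    case one
    then show ?case
      using a fc hom_one [OF pth_map_hom [OF f] group_Pth group_Pth]
      by (simp add: X.pth_act_one Y.pth_act_one)
  next
    case (gen k y)
    have "pth_act Y (f a) (pth_map Y f (k \<otimes>\<^bsub>Pth X\<^esub> gen X y)) = rop Y (pth_act Y (f a) (pth_map Y f k)) (f y)"
      using gen a fc m hom_mult [OF pth_map_hom [OF f], of k "gen X y"] f
      by (simp add: Y.pth_act_mult Y.pth_act_gen pth_map_gen)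
    moreover have "f (pth_act X a (k \<otimes>\<^bsub>Pth X\<^esub> gen X y)) = rop Y (f (pth_act X a k)) (f y)"
      using gen a by (simp add: X.pth_act_mult X.pth_act_gen fr)
    ultimately show ?case
      using gen a fc m Y.rop_rinv by (metis X.pth_act_closed Y.pth_act_closed)
  qed
qed

text \<open>The two hypotheses on \<open>pth_map\<close> make \<open>cover_map\<close> a morphism between the covers. All maps
  induced by \<open>f\<close> can then be compared on representatives.\<close>
locale path_cover_hom = X: path_cover X H \<delta> X' + Y: path_cover Y H' \<delta>' Y'
  for X :: "'a rack" and H \<delta> X' and Y :: "'b rack" and H' \<delta>' Y' +
  fixes f :: "'a \<Rightarrow> 'b"
  assumes f_hom: "f \<in> rack_hom X Y"
    and pth_map_H: "k \<in> H \<Longrightarrow> pth_map Y f k \<in> H'"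
    and pth_map_delta: "\<lbrakk>p \<in> carrier X; y \<in> carrier X\<rbrakk> \<Longrightarrow> pth_map Y f (\<delta> p y) = \<delta>' (f p) (f y)"
begin

abbreviation lift where "lift \<equiv> cover_map Y f"

lemma f_closed [simp]: "a \<in> carrier X \<Longrightarrow> f a \<in> carrier Y"
  using f_hom by (auto simp: rack_hom_def)

lemma pth_map_mult [simp]:
  "\<lbrakk>k \<in> H; l \<in> H\<rbrakk> \<Longrightarrow> pth_map Y f (k \<otimes>\<^bsub>Pth X\<^esub> l) = pth_map Y f k \<otimes>\<^bsub>Pth Y\<^esub> pth_map Y f l"
  by (simp add: hom_mult [OF pth_map_hom [OF f_hom]])

lemma pth_map_one: "pth_map Y f \<one>\<^bsub>Pth X\<^esub> = \<one>\<^bsub>Pth Y\<^esub>"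
  by (rule hom_one [OF pth_map_hom [OF f_hom] group_Pth group_Pth])

lemma pth_map_inv: "k \<in> H \<Longrightarrow> pth_map Y f (inv\<^bsub>Pth X\<^esub> k) = inv\<^bsub>Pth Y\<^esub> pth_map Y f k"
proof -
  interpret group_hom "Pth X" "Pth Y" "pth_map Y f"
    by (intro group_hom.intro group_hom_axioms.intro group_Pth pth_map_hom f_hom)
  show "k \<in> H \<Longrightarrow> ?thesis" by (simp add: hom_inv)
qed

lemma pth_act_f:
  "\<lbrakk>a \<in> carrier X; k \<in> H\<rbrakk> \<Longrightarrow> pth_act Y (f a) (pth_map Y f k) = f (pth_act X a k)"
  by (rule pth_act_map [OF X.rack_axioms Y.rack_axioms f_hom]) auto

lemma lift_closed: "u \<in> carrier X' \<Longrightarrow> lift u \<in> carrier Y'"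
  by (auto simp: cover_map_def X.carrier_X' Y.carrier_X' pth_map_H)

lemma omega_lift: "u \<in> carrier X' \<Longrightarrow> omega Y (lift u) = f (omega X u)"
  by (auto simp: cover_map_def X.carrier_X' omega_def pth_act_f)

lemma lift_hom: "lift \<in> rack_hom X' Y'"
proof -
  have "lift (rop X' u v) = rop Y' (lift u) (lift v)" if u: "u \<in> carrier X'" and v: "v \<in> carrier X'" for u v
  proof -
    show ?thesis
      using u v X.delta_closed [OF X.omega_closed [OF u] X.omega_closed [OF v]]
      by (simp add: X.rop_X' Y.rop_X' lift_closed omega_lift)
        (auto simp: cover_map_def X.carrier_X' pth_map_delta X.omega_closed)
  qed
  then show ?thesis by (simp add: rack_hom_def lift_closed)
qed

lemma lift_pair_hom: "map_prod lift lift \<in> rack_hom (iarr X.ker_pair) (iarr Y.ker_pair)"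
proof -
  have "lift (rop X' u v) = rop Y' (lift u) (lift v)" if "u \<in> carrier X'" "v \<in> carrier X'" for u v
    using lift_hom that by (simp add: rack_hom_def)
  then show ?thesis
    by (simp add: rack_hom_def X.carrier_arr Y.carrier_arr X.rop_arr Y.rop_arr omega_lift lift_closed
        Pi_iff split_paired_all)
qed

lemma can_obj_natural:
  assumes "C \<in> pi0 X'"
  shows "can_obj (pi0_map Y' lift C) = f (can_obj C)"
  using assms
  by (rule pi0_cases)
    (simp add: pi0_map_class [OF lift_hom] X.can_obj_class Y.can_obj_class lift_closed, simp add: cover_map_def)

lemma can_arr_natural:
  assumes "C \<in> pi0 (iarr X.ker_pair)"
  shows "can_arr Y (pi0_map (iarr Y.ker_pair) (map_prod lift lift) C) = action_gpd_map f (pth_map Y f) (can_arr X C)"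
proof -
  obtain p where p: "p \<in> carrier (iarr X.ker_pair)" "C = conn (iarr X.ker_pair) `` {p}"
    using assms by (rule pi0_cases)
  have "map_prod lift lift p \<in> carrier (iarr Y.ker_pair)" using lift_pair_hom p by (auto simp: rack_hom_def)
  moreover have "Y.arr_invariant (map_prod lift lift p) = action_gpd_map f (pth_map Y f) (X.arr_invariant p)"
    using p by (auto simp: X.carrier_arr X.carrier_X' X.arr_invariant_def Y.arr_invariant_def
        cover_map_def action_gpd_map_def pth_map_inv)
  ultimately show ?thesis
    using p by (simp add: pi0_map_class [OF lift_pair_hom] X.can_arr_class Y.can_arr_class)
qed

lemma action_hom: "groupoid_hom X.act_gpd Y.act_gpd f (action_gpd_map f (pth_map Y f))"
proof -
  have "inv\<^bsub>(Pth X)\<lparr>carrier := H\<rparr>\<^esub> k = inv\<^bsub>Pth X\<^esub> k" if "k \<in> H" for k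
    using X.P.m_inv_consistent [OF X.subgroup_H that] by simp
  moreover have "inv\<^bsub>(Pth Y)\<lparr>carrier := H'\<rparr>\<^esub> k = inv\<^bsub>Pth Y\<^esub> k" if "k \<in> H'" for k
    using Y.P.m_inv_consistent [OF Y.subgroup_H that] by simp
  ultimately show ?thesis
    unfolding groupoid_hom_def
    by (intro conjI X.groupoid_action Y.groupoid_action)
      (auto simp: action_gpd_def action_gpd_map_def pth_map_H pth_act_f pth_map_one pth_map_inv)
qed

text \<open>Preservation of the structure, composition in particular, is inherited from
  \<open>action_hom\<close> through the two isomorphisms.\<close>
lemma pi0_groupoid_hom:
  "groupoid_hom (pi0_gpd X.ker_pair) (pi0_gpd Y.ker_pair) (pi0_map Y' lift) (pi0_map (iarr Y.ker_pair) (map_prod lift lift))"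
proof (rule groupoid_hom_transport [OF X.pi0_groupoid_iso Y.pi0_groupoid_iso action_hom])
  show "pi0_map Y' lift \<in> Obj (pi0_gpd X.ker_pair) \<rightarrow> Obj (pi0_gpd Y.ker_pair)"
    using pi0_map_closed [OF lift_hom] by (simp add: pi0_gpd_def kernel_pair_def)
  show "pi0_map (iarr Y.ker_pair) (map_prod lift lift) \<in> Arr (pi0_gpd X.ker_pair) \<rightarrow> Arr (pi0_gpd Y.ker_pair)"
    using pi0_map_closed [OF lift_pair_hom] by (simp add: pi0_gpd_def)
  show "can_obj (pi0_map Y' lift C) = f (can_obj C)" if "C \<in> Obj (pi0_gpd X.ker_pair)" for C
    using that can_obj_natural by (simp add: pi0_gpd_def kernel_pair_def)
  show "can_arr Y (pi0_map (iarr Y.ker_pair) (map_prod lift lift) C) = action_gpd_map f (pth_map Y f) (can_arr X C)"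
    if "C \<in> Arr (pi0_gpd X.ker_pair)" for C
    using that can_arr_natural by (simp add: pi0_gpd_def)
qed

end

section \<open>The weakly universal covers of racks and quandles\<close>

text \<open>For racks, \<open>v\<close> translates by the generator given by its image in \<open>X\<close>, and the
  generators generate the path group.\<close>
lemma (in rack) path_cover_cover: "path_cover X (carrier (Pth X)) (\<lambda>p. gen X) (cover X)"
proof (intro path_cover.intro path_cover_axioms.intro rack_axioms)
  show "subgroup (carrier (Pth X)) (Pth X)" by (rule P.subgroup_self)
  show "carrier (cover X) = carrier X \<times> carrier (Pth X)" by (simp add: cover_def)
  show "u \<triangleleft>\<^bsub>cover X\<^esub> v = (fst u, snd u \<otimes>\<^bsub>Pth X\<^esub> gen X (omega X v))"
    if "u \<in> carrier (cover X)" "v \<in> carrier (cover X)" for u v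
    using that by (auto simp: cover_def omega_def gen_pth_act P.m_assoc)
  fix p k Q
  assume "k \<in> carrier (Pth X)" and one: "Q \<one>\<^bsub>Pth X\<^esub>"
    and step: "\<And>k y. \<lbrakk>k \<in> carrier (Pth X); y \<in> carrier X\<rbrakk> \<Longrightarrow> Q k \<longleftrightarrow> Q (k \<otimes>\<^bsub>Pth X\<^esub> gen X y)"
  from this(1) show "Q k"
    by (rule Pth_induct [OF _ one step])
qed simp

lemma pth_deg_group_hom: "group_hom (Pth X) integer_group pth_deg"
  by (intro group_hom.intro group_hom_axioms.intro group_Pth group_integer_group pth_deg_hom)

lemma carrier_Pth0: "carrier (Pth0 X) = {g \<in> carrier (Pth X). pth_deg g = 0}"
  by (simp add: Pth0_def kernel_def)

text \<open>For quandles, moving the factor \<open>(gen a)\<inverse>\<close> past \<open>g\<close> turns it into the inverse of the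
  generator given by the image \<open>a \<cdot> g\<close>, so that the operation is a right translation again,
  now by an element of degree zero. To reach every path of degree zero from \<open>p\<close>, any path
  \<open>k\<close> is normalised to the path \<open>n k\<close> of degree zero, obtained by multiplying \<open>k\<close> on the
  left by a power of \<open>gen p\<close>. Passing from \<open>k\<close> to \<open>k \<otimes> gen y\<close> changes \<open>n k\<close> by exactly one
  of the available translations, so that induction over the whole path group
  applies.\<close>
lemma (in quandle) path_cover_qcover:
  "path_cover X (carrier (Pth0 X)) (\<lambda>p y. inv\<^bsub>Pth X\<^esub> gen X p \<otimes>\<^bsub>Pth X\<^esub> gen X y) (qcover X)"
proof (intro path_cover.intro path_cover_axioms.intro rack_axioms)
  interpret deg: group_hom "Pth X" integer_group pth_deg by (rule pth_deg_group_hom)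
  have dm: "pth_deg (g \<otimes>\<^bsub>Pth X\<^esub> h) = pth_deg g + pth_deg h"
    if "g \<in> carrier (Pth X)" "h \<in> carrier (Pth X)" for g h
    using deg.hom_mult [OF that] by simp
  have di: "pth_deg (inv\<^bsub>Pth X\<^esub> g) = - pth_deg g" if "g \<in> carrier (Pth X)" for g
    using deg.hom_inv [OF that] by simp
  have dp: "pth_deg (gen X p [^]\<^bsub>Pth X\<^esub> (i :: int)) = i" if "p \<in> carrier X" for p i
    using deg.hom_int_pow [of "gen X p" i] that by (simp add: pth_deg_gen)
  show "subgroup (carrier (Pth0 X)) (Pth X)"
    using deg.subgroup_kernel by (simp add: Pth0_def)
  show d: "inv\<^bsub>Pth X\<^esub> gen X p \<otimes>\<^bsub>Pth X\<^esub> gen X y \<in> carrier (Pth0 X)"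
    if "p \<in> carrier X" "y \<in> carrier X" for p y
    using that by (simp add: carrier_Pth0 dm di pth_deg_gen)
  show "carrier (qcover X) = carrier X \<times> carrier (Pth0 X)" by (simp add: qcover_def)
  show "u \<triangleleft>\<^bsub>qcover X\<^esub> v = (fst u, snd u \<otimes>\<^bsub>Pth X\<^esub> (inv\<^bsub>Pth X\<^esub> gen X (omega X u) \<otimes>\<^bsub>Pth X\<^esub> gen X (omega X v)))"
    if "u \<in> carrier (qcover X)" "v \<in> carrier (qcover X)" for u v
    using that
    by (auto simp: qcover_def omega_def gen_pth_act P.m_assoc P.inv_mult_group carrier_Pth0 P_cancel)
  fix p k Q
  assume p: "p \<in> carrier X" and k: "k \<in> carrier (Pth0 X)" and one: "Q \<one>\<^bsub>Pth X\<^esub>"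
    and step: "\<And>k y. \<lbrakk>k \<in> carrier (Pth0 X); y \<in> carrier X\<rbrakk> \<Longrightarrow>
      Q k \<longleftrightarrow> Q (k \<otimes>\<^bsub>Pth X\<^esub> (inv\<^bsub>Pth X\<^esub> gen X (pth_act X p k) \<otimes>\<^bsub>Pth X\<^esub> gen X y))"
  define n where "n k = gen X p [^]\<^bsub>Pth X\<^esub> (- pth_deg k) \<otimes>\<^bsub>Pth X\<^esub> k" for k
  have n: "n k \<in> carrier (Pth0 X)" if "k \<in> carrier (Pth X)" for k
    using that p by (simp add: n_def carrier_Pth0 dm dp)
  have nk: "n k = k" if "k \<in> carrier (Pth0 X)" for k
    using that by (simp add: n_def carrier_Pth0)
  have "k \<in> carrier (Pth X)" using k by (simp add: carrier_Pth0)
  then have "Q (n k)"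
  proof (induction rule: Pth_induct)
    case one
    then show ?case using \<open>Q \<one>\<^bsub>Pth X\<^esub>\<close> deg.hom_one by (simp add: n_def)
  next
    case (gen k y)
    have c: "n k \<in> carrier (Pth X)" using n [OF gen(1)] by (simp add: carrier_Pth0)
    have "- pth_deg (k \<otimes>\<^bsub>Pth X\<^esub> gen X y) = - 1 + - pth_deg k"
      using gen by (simp add: dm pth_deg_gen)
    then have "gen X p [^]\<^bsub>Pth X\<^esub> (- pth_deg (k \<otimes>\<^bsub>Pth X\<^esub> gen X y))
        = gen X p [^]\<^bsub>Pth X\<^esub> (- 1 + - pth_deg k)" by simp
    also have "\<dots> = gen X p [^]\<^bsub>Pth X\<^esub> (- 1 :: int) \<otimes>\<^bsub>Pth X\<^esub> gen X p [^]\<^bsub>Pth X\<^esub> (- pth_deg k)"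
      by (rule P.int_pow_mult) (use p in simp)
    also have "gen X p [^]\<^bsub>Pth X\<^esub> (- 1 :: int) = inv\<^bsub>Pth X\<^esub> gen X p"
      using p by (simp add: P.int_pow_neg)
    finally have "n (k \<otimes>\<^bsub>Pth X\<^esub> gen X y) = inv\<^bsub>Pth X\<^esub> gen X p \<otimes>\<^bsub>Pth X\<^esub> n k \<otimes>\<^bsub>Pth X\<^esub> gen X y"
      using gen p by (simp add: n_def P.m_assoc)
    also have "\<dots> = n k \<otimes>\<^bsub>Pth X\<^esub> (inv\<^bsub>Pth X\<^esub> gen X (pth_act X p (n k)) \<otimes>\<^bsub>Pth X\<^esub> gen X y)"
      using gen p c by (simp add: gen_pth_act P.m_assoc P.inv_mult_group P_cancel)
    finally show ?case using step [OF n [OF gen(1)] gen(2)] by simp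
  qed
  then show "Q k" using nk k by simp
qed

lemma pth_deg_pth_map:
  assumes "f \<in> rack_hom X Y" "k \<in> carrier (Pth X)"
  shows "pth_deg (pth_map Y f k) = pth_deg k"
proof -
  have f: "f \<in> carrier X \<rightarrow> carrier Y" using assms(1) by (simp add: rack_hom_def)
  have "word_deg (map (apsnd f) w) = word_deg w" for w :: "'a word"
    by (induction w) (auto simp: word_deg_def)
  then show ?thesis
    using assms(2) by (auto simp: carrier_Pth pth_map_class [OF assms(1)] pth_deg_class map_words [OF f])
qed

lemma path_cover_hom_cover:
  assumes "rack X" "rack Y" "f \<in> rack_hom X Y"
  shows "path_cover_hom X (carrier (Pth X)) (\<lambda>p. gen X) (cover X)
    Y (carrier (Pth Y)) (\<lambda>p. gen Y) (cover Y) f"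
  using assms hom_in_carrier [OF pth_map_hom [OF assms(3)]]
  by (intro path_cover_hom.intro rack.path_cover_cover path_cover_hom_axioms.intro)
    (simp_all add: pth_map_gen)

lemma path_cover_hom_qcover:
  assumes "quandle X" "quandle Y" "f \<in> rack_hom X Y"
  shows "path_cover_hom X (carrier (Pth0 X)) (\<lambda>p y. inv\<^bsub>Pth X\<^esub> gen X p \<otimes>\<^bsub>Pth X\<^esub> gen X y) (qcover X)
    Y (carrier (Pth0 Y)) (\<lambda>p y. inv\<^bsub>Pth Y\<^esub> gen Y p \<otimes>\<^bsub>Pth Y\<^esub> gen Y y) (qcover Y) f"
proof -
  interpret X: quandle X by fact
  interpret Y: quandle Y by fact
  interpret group_hom "Pth X" "Pth Y" "pth_map Y f"
    by (intro group_hom.intro group_hom_axioms.intro group_Pth pth_map_hom assms)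
  show ?thesis
    using assms
    by (intro path_cover_hom.intro quandle.path_cover_qcover path_cover_hom_axioms.intro)
      (simp_all add: pth_map_gen carrier_Pth0 pth_deg_pth_map)
qed


text \<open>These identify the action groupoids of the general setting with those of \<open>Pth X\<close> and
  \<open>Pth0 X\<close>.\<close>
lemma Pth_carrier_update: "(Pth X)\<lparr>carrier := carrier (Pth X)\<rparr> = Pth X"
  "(Pth X)\<lparr>carrier := carrier (Pth0 X)\<rparr> = Pth0 X"
  by (simp_all add: Pth0_def)

theorem theorem3p5p2p1:
  fixes X :: "'a rack" and Y :: "'b rack" and f :: "'a \<Rightarrow> 'b"
  shows
    "(rack X \<longrightarrow>
        pi0_preserves_composables (cover_gpd X) \<and>
        groupoid_iso (pi1 X) (action_gpd (carrier X) (Pth X) (pth_act X)) can_obj (can_arr X))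
   \<and> (quandle X \<longrightarrow>
        pi0_preserves_composables (qcover_gpd X) \<and>
        groupoid_iso (pi1q X) (action_gpd (carrier X) (Pth0 X) (pth_act X)) can_obj (can_arr X))
   \<and> (rack X \<and> rack Y \<and> f \<in> rack_hom X Y \<longrightarrow>
        groupoid_hom (pi1 X) (pi1 Y) (pi1_obj_map Y f) (pi1_arr_map Y f) \<and>
        groupoid_hom (action_gpd (carrier X) (Pth X) (pth_act X))
          (action_gpd (carrier Y) (Pth Y) (pth_act Y)) f (action_gpd_map f (pth_map Y f)) \<and>
        (\<forall>C\<in>Obj (pi1 X). can_obj (pi1_obj_map Y f C) = f (can_obj C)) \<and>
        (\<forall>A\<in>Arr (pi1 X).
           can_arr Y (pi1_arr_map Y f A) = action_gpd_map f (pth_map Y f) (can_arr X A)))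
   \<and> (quandle X \<and> quandle Y \<and> f \<in> rack_hom X Y \<longrightarrow>
        groupoid_hom (pi1q X) (pi1q Y) (pi1q_obj_map Y f) (pi1q_arr_map Y f) \<and>
        groupoid_hom (action_gpd (carrier X) (Pth0 X) (pth_act X))
          (action_gpd (carrier Y) (Pth0 Y) (pth_act Y)) f (action_gpd_map f (pth_map Y f)) \<and>
        (\<forall>C\<in>Obj (pi1q X). can_obj (pi1q_obj_map Y f C) = f (can_obj C)) \<and>
        (\<forall>A\<in>Arr (pi1q X).
           can_arr Y (pi1q_arr_map Y f A) = action_gpd_map f (pth_map Y f) (can_arr X A)))"
proof (intro conjI [of "rack X \<longrightarrow> _"] conjI [of "quandle X \<longrightarrow> _"]
    conjI [of "rack X \<and> rack Y \<and> f \<in> rack_hom X Y \<longrightarrow> _"] impI; (elim conjE)?)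
  have sel: "iobj (cover_gpd Z) = cover Z" "Obj (pi1 Z) = pi0 (cover Z)"
    "Arr (pi1 Z) = pi0 (iarr (cover_gpd Z))"
    "iobj (qcover_gpd Z) = qcover Z" "Obj (pi1q Z) = pi0 (qcover Z)"
    "Arr (pi1q Z) = pi0 (iarr (qcover_gpd Z))" for Z :: "'c rack"
    by (simp_all add: pi1_def pi1q_def cover_gpd_def qcover_gpd_def kernel_pair_def pi0_gpd_def)
  show "pi0_preserves_composables (cover_gpd X) \<and>
      groupoid_iso (pi1 X) (action_gpd (carrier X) (Pth X) (pth_act X)) can_obj (can_arr X)"
    if "rack X"
  proof -
    interpret path_cover X "carrier (Pth X)" "\<lambda>p. gen X" "cover X"
      using that by (rule rack.path_cover_cover)
    show ?thesis
      using preserves_composables pi0_groupoid_iso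
      by (simp add: cover_gpd_def pi1_def Pth_carrier_update)
  qed
  show "pi0_preserves_composables (qcover_gpd X) \<and>
      groupoid_iso (pi1q X) (action_gpd (carrier X) (Pth0 X) (pth_act X)) can_obj (can_arr X)"
    if "quandle X"
  proof -
    interpret path_cover X "carrier (Pth0 X)" "\<lambda>p y. inv\<^bsub>Pth X\<^esub> gen X p \<otimes>\<^bsub>Pth X\<^esub> gen X y" "qcover X"
      using that by (rule quandle.path_cover_qcover)
    show ?thesis
      using preserves_composables pi0_groupoid_iso
      by (simp add: qcover_gpd_def pi1q_def Pth_carrier_update)
  qed
  show "groupoid_hom (pi1 X) (pi1 Y) (pi1_obj_map Y f) (pi1_arr_map Y f) \<and>
        groupoid_hom (action_gpd (carrier X) (Pth X) (pth_act X))
          (action_gpd (carrier Y) (Pth Y) (pth_act Y)) f (action_gpd_map f (pth_map Y f)) \<and>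
        (\<forall>C\<in>Obj (pi1 X). can_obj (pi1_obj_map Y f C) = f (can_obj C)) \<and>
        (\<forall>A\<in>Arr (pi1 X).
           can_arr Y (pi1_arr_map Y f A) = action_gpd_map f (pth_map Y f) (can_arr X A))"
    if "rack X" "rack Y" "f \<in> rack_hom X Y"
  proof -
    interpret path_cover_hom X "carrier (Pth X)" "\<lambda>p. gen X" "cover X"
      Y "carrier (Pth Y)" "\<lambda>p. gen Y" "cover Y" f
      using that by (rule path_cover_hom_cover)
    show ?thesis
      using pi0_groupoid_hom action_hom can_obj_natural can_arr_natural
      unfolding pi1_obj_map_def [abs_def] pi1_arr_map_def [abs_def] sel
      by (simp add: Pth_carrier_update pi1_def cover_gpd_def)
  qed
  show "groupoid_hom (pi1q X) (pi1q Y) (pi1q_obj_map Y f) (pi1q_arr_map Y f) \<and>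
        groupoid_hom (action_gpd (carrier X) (Pth0 X) (pth_act X))
          (action_gpd (carrier Y) (Pth0 Y) (pth_act Y)) f (action_gpd_map f (pth_map Y f)) \<and>
        (\<forall>C\<in>Obj (pi1q X). can_obj (pi1q_obj_map Y f C) = f (can_obj C)) \<and>
        (\<forall>A\<in>Arr (pi1q X).
           can_arr Y (pi1q_arr_map Y f A) = action_gpd_map f (pth_map Y f) (can_arr X A))"
    if "quandle X" "quandle Y" "f \<in> rack_hom X Y"
  proof -
    interpret path_cover_hom X "carrier (Pth0 X)" "\<lambda>p y. inv\<^bsub>Pth X\<^esub> gen X p \<otimes>\<^bsub>Pth X\<^esub> gen X y" "qcover X"
      Y "carrier (Pth0 Y)" "\<lambda>p y. inv\<^bsub>Pth Y\<^esub> gen Y p \<otimes>\<^bsub>Pth Y\<^esub> gen Y y" "qcover Y" f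
      using that by (rule path_cover_hom_qcover)
    show ?thesis
      using pi0_groupoid_hom action_hom can_obj_natural can_arr_natural
      unfolding pi1q_obj_map_def [abs_def] pi1q_arr_map_def [abs_def] sel
      by (simp add: Pth_carrier_update pi1q_def qcover_gpd_def)
  qed
qed

end
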